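(* Let $K$ be a field, $E=(E^0,E^1,r,s)$ a graph, $V$ a $K$-module (vector space) and $\Phi:L_K(E)\to\mathrm{Hom}_K(V)$ a representation. With the subspaces $V_u$, $V_e$, $\overline{V_u}$, $\overline{V}$, $W$ of $V$ and the representation $\Phi_1$ as in the context, choose an adapted basis $\{m_x\}$ of $V$ (as described in the context), with index sets $R_e$ ($e\in E^1$), $D_u$ ($u\in E^0$) and $\overline{I}$. Suppose that $$\Phi(e)(\{m_x:x\in D_{r(e)}\})=\{m_y:y\in R_e\}\quad\text{for each } e\in E^1,$$ and suppose that $\Phi(e^* )(\overline{V_{s(e)}})=0$ for all $e\in E^1$ (a condition that is vacuous for those $e$ with $s^{-1}(s(e))$ finite). Let $X=\bigcup_{u\in E^0}D_u$, $Y=X\cup\overline{I}$, $M=\{g:X\to K : g(x)\ne 0 \text{ only for finitely many } x\in X\}$ and $N=\{g:Y\to K: g(x)\neq 0\text{ only for finitely many }x\in Y\}$. Then: 1. There exists a representation $\pi:L_K(E)\to\mathrm{Hom}_K(M)$, induced by an $E$-algebraic branching system, which is equivalent to $\Phi_1$ (the restriction of $\Phi$ to $W$). 2. If $\overline{V}$ may be chosen such that $\Phi(u)(\overline{V})=0$ for each $u\in E^0$, then there exists an $E$-algebraic branching system which induces a representation $\pi:L_K(E)\to\mathrm{Hom}_K(N)$ which is equivalent to $\Phi$.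
   Context: A graph $E=(E^0,E^1,r,s)$ is a directed graph with countable vertex set $E^0$, countable edge set $E^1$, and range and source maps $r,s:E^1\to E^0$. The Leavitt path algebra $L_K(E)$ is the universal $K$-algebra (not necessarily unital) generated by a set $\{v:v\in E^0\}$ of pairwise orthogonal idempotents together with elements $\{e,e^*:e\in E^1\}$ satisfying: (1) $s(e)e=er(e)=e$ for all $e\in E^1$; (2) $r(e)e^*=e^*s(e)=e^*$ for all $e\in E^1$; (3) $e^*f=\delta_{e,f}r(e)$ for all $e,f\in E^1$; (4) $v=\sum_{e:s(e)=v}ee^*$ for every vertex $v$ with $0<\#\{e:s(e)=v\}<\infty$. A representation is a $K$-algebra homomorphism $L_K(E)\to\mathrm{Hom}_K(V)$, where $\mathrm{Hom}_K(V)$ is the $K$-algebra of $K$-linear maps $V\to V$ under composition. An $E$-algebraic branching system consists of a set $X$, subsets $R_e$ ($e\in E^1$) and $D_v$ ($v\in E^0$) of $X$, and maps $f_e$ such that: the $R_e$ are pairwise disjoint; the $D_v$ are pairwise disjoint; $R_e\subseteq D_{s(e)}$; $D_v=\bigcup_{e:s(e)=v}R_e$ if $0<\#\{e:s(e)=v\}<\infty$; and each $f_e:D_{r(e)}\to R_e$ is a bijection. The representation it induces on the module of finitely supported functions $X\to K$ is the homomorphism $\pi$ determined by: $\pi(e)(\phi)(x)=\phi(f_e^{-1}(x))$ if $x\in R_e$ and $0$ otherwise; $\pi(e^* )(\phi)(x)=\phi(f_e(x))$ if $x\in D_{r(e)}$ and $0$ otherwise; $\pi(v)(\phi)(x)=\phi(x)$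 if $x\in D_v$ and $0$ otherwise. Subspaces. $V_u=\Phi(u)(V)$ for $u\in E^0$ and $V_e=\Phi(e)\Phi(e^* )(V)$ for $e\in E^1$. One has $V_u=\bigoplus_{e:s(e)=u}V_e$ if $0<\#\{e:s(e)=u\}<\infty$. If $\#\{e:s(e)=u\}=\infty$, $\overline{V_u}$ is a chosen subspace with $V_u=\left(\bigoplus_{e:s(e)=u}V_e\right)\oplus\overline{V_u}$. Put $W=\bigoplus_{u\in E^0}V_u\subseteq V$, and let $\overline{V}$ be a chosen subspace with $V=W\oplus\overline{V}$. Since $\Phi(a)(V)\subseteq W$ for all $a\in L_K(E)$, $\Phi$ restricts to a representation $\Phi_1:L_K(E)\to\mathrm{Hom}_K(W)$, $\Phi_1(a)=\Phi(a)|_W$. Adapted basis. Choose a basis $\{m_x:x\in R_e\}$ of each $V_e$; a basis $\{m_x:x\in\overline{I_u}\}$ of $\overline{V_u}$ for each $u$ with $\#s^{-1}(u)=\infty$; a basis $\{m_x:x\in D_u\}$ of $V_u$ for each $u$ with $s^{-1}(u)=\emptyset$; and a basis $\{m_x:x\in\overline{I}\}$ of $\overline{V}$; all these index sets being chosen pairwise disjoint. For $u$ with $0<\#s^{-1}(u)<\infty$ put $D_u=\bigcup_{e:s(e)=u}R_e$, and for $u$ with $\#s^{-1}(u)=\infty$ put $D_u=\left(\bigcup_{e:s(e)=u}R_e\right)\cup\overline{I_u}$. Thus $\{m_x:x\in D_u\}$ is a basis of $V_u$ for every $u\in E^0$, and $\{m_x: x\in\bigcup_u D_u\cup\overline I\}$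 is a basis of $V$. Equivalence. Representations $\pi:L_K(E)\to\mathrm{Hom}_K(M)$ and $\Phi:L_K(E)\to\mathrm{Hom}_K(W)$ are equivalent if there is a $K$-module isomorphism $U:W\to M$ with $U\circ\Phi(a)=\pi(a)\circ U$ for every $a\in L_K(E)$. *)

theory Defs
  imports
    Complex_Main
    "HOL-Library.FuncSet"
    "HOL-Library.Disjoint_Sets"
    "HOL-Library.Countable_Set"
    "HOL-Library.Function_Algebras"
    "Graph_Theory.Digraph"
begin

section \<open>Associative algebras without unit\<close>

record ('k, 'a) nalg =
  nalg_carrier :: "'a set"
  nalg_zero :: 'a
  nalg_add :: "'a \<Rightarrow> 'a \<Rightarrow> 'a"
  nalg_scale :: "'k \<Rightarrow> 'a \<Rightarrow> 'a"
  nalg_mult :: "'a \<Rightarrow> 'a \<Rightarrow> 'a"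

locale nonunital_algebra =
  fixes A :: "('k::field, 'a) nalg"
  assumes zero_closed: "nalg_zero A \<in> nalg_carrier A"
    and add_closed: "\<lbrakk>a \<in> nalg_carrier A; b \<in> nalg_carrier A\<rbrakk> \<Longrightarrow> nalg_add A a b \<in> nalg_carrier A"
    and scale_closed: "a \<in> nalg_carrier A \<Longrightarrow> nalg_scale A k a \<in> nalg_carrier A"
    and mult_closed: "\<lbrakk>a \<in> nalg_carrier A; b \<in> nalg_carrier A\<rbrakk> \<Longrightarrow> nalg_mult A a b \<in> nalg_carrier A"
    and add_comm: "\<lbrakk>a \<in> nalg_carrier A; b \<in> nalg_carrier A\<rbrakk> \<Longrightarrow> nalg_add A a b = nalg_add A b a"
    and add_assoc: "\<lbrakk>a \<in> nalg_carrier A; b \<in> nalg_carrier A; c \<in> nalg_carrier A\<rbrakk> \<Longrightarrow>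
      nalg_add A (nalg_add A a b) c = nalg_add A a (nalg_add A b c)"
    and add_zero: "a \<in> nalg_carrier A \<Longrightarrow> nalg_add A a (nalg_zero A) = a"
    and add_minus: "a \<in> nalg_carrier A \<Longrightarrow> nalg_add A a (nalg_scale A (-1) a) = nalg_zero A"
    and scale_one: "a \<in> nalg_carrier A \<Longrightarrow> nalg_scale A 1 a = a"
    and scale_scale: "a \<in> nalg_carrier A \<Longrightarrow> nalg_scale A k (nalg_scale A l a) = nalg_scale A (k * l) a"
    and scale_add_right: "\<lbrakk>a \<in> nalg_carrier A; b \<in> nalg_carrier A\<rbrakk> \<Longrightarrow>
      nalg_scale A k (nalg_add A a b) = nalg_add A (nalg_scale A k a) (nalg_scale A k b)"
    and scale_add_left: "a \<in> nalg_carrier A \<Longrightarrow>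
      nalg_scale A (k + l) a = nalg_add A (nalg_scale A k a) (nalg_scale A l a)"
    and mult_assoc: "\<lbrakk>a \<in> nalg_carrier A; b \<in> nalg_carrier A; c \<in> nalg_carrier A\<rbrakk> \<Longrightarrow>
      nalg_mult A (nalg_mult A a b) c = nalg_mult A a (nalg_mult A b c)"
    and mult_add_right: "\<lbrakk>a \<in> nalg_carrier A; b \<in> nalg_carrier A; c \<in> nalg_carrier A\<rbrakk> \<Longrightarrow>
      nalg_mult A a (nalg_add A b c) = nalg_add A (nalg_mult A a b) (nalg_mult A a c)"
    and mult_add_left: "\<lbrakk>a \<in> nalg_carrier A; b \<in> nalg_carrier A; c \<in> nalg_carrier A\<rbrakk> \<Longrightarrow>
      nalg_mult A (nalg_add A a b) c = nalg_add A (nalg_mult A a c) (nalg_mult A b c)"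
    and mult_scale_left: "\<lbrakk>a \<in> nalg_carrier A; b \<in> nalg_carrier A\<rbrakk> \<Longrightarrow>
      nalg_mult A (nalg_scale A k a) b = nalg_scale A k (nalg_mult A a b)"
    and mult_scale_right: "\<lbrakk>a \<in> nalg_carrier A; b \<in> nalg_carrier A\<rbrakk> \<Longrightarrow>
      nalg_mult A a (nalg_scale A k b) = nalg_scale A k (nalg_mult A a b)"

definition nalg_hom :: "('k, 'a) nalg \<Rightarrow> ('k, 'b) nalg \<Rightarrow> ('a \<Rightarrow> 'b) set" where
  "nalg_hom A B = {h \<in> nalg_carrier A \<rightarrow> nalg_carrier B.
     (\<forall>a\<in>nalg_carrier A. \<forall>b\<in>nalg_carrier A. h (nalg_add A a b) = nalg_add B (h a) (h b)) \<and>
     (\<forall>k. \<forall>a\<in>nalg_carrier A. h (nalg_scale A k a) = nalg_scale B k (h a)) \<and>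
     (\<forall>a\<in>nalg_carrier A. \<forall>b\<in>nalg_carrier A. h (nalg_mult A a b) = nalg_mult B (h a) (h b))}"


section \<open>The algebra presented by generators and relations\<close>

text \<open>
  The universal algebra on generators \<open>S\<close> subject to relations \<open>R\<close> is realised as the algebra of
  formal expressions in \<open>S\<close> modulo the least congruence that contains \<open>R\<close> and the algebra axioms.
  Its universal property is proved below.
\<close>

datatype ('k, 'g) alg_term =
    Gen 'g
  | TZero
  | TAdd "('k, 'g) alg_term" "('k, 'g) alg_term"
  | TScale 'k "('k, 'g) alg_term"
  | TMul "('k, 'g) alg_term" "('k, 'g) alg_term"

primrec term_gens :: "('k, 'g) alg_term \<Rightarrow> 'g set" where
  "term_gens (Gen g) = {g}"
| "term_gens TZero = {}"
| "term_gens (TAdd t u) = term_gens t \<union> term_gens u"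
| "term_gens (TScale k t) = term_gens t"
| "term_gens (TMul t u) = term_gens t \<union> term_gens u"

inductive term_eq ::
  "(('k::field, 'g) alg_term \<times> ('k, 'g) alg_term) set \<Rightarrow> ('k, 'g) alg_term \<Rightarrow> ('k, 'g) alg_term \<Rightarrow> bool"
  for R where
  rel: "(t, u) \<in> R \<Longrightarrow> term_eq R t u"
| refl: "term_eq R t t"
| sym: "term_eq R t u \<Longrightarrow> term_eq R u t"
| trans: "term_eq R t u \<Longrightarrow> term_eq R u w \<Longrightarrow> term_eq R t w"
| add_cong: "term_eq R t t' \<Longrightarrow> term_eq R u u' \<Longrightarrow> term_eq R (TAdd t u) (TAdd t' u')"
| scale_cong: "term_eq R t t' \<Longrightarrow> term_eq R (TScale k t) (TScale k t')"
| mul_cong: "term_eq R t t' \<Longrightarrow> term_eq R u u' \<Longrightarrow> term_eq R (TMul t u) (TMul t' u')"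
| add_comm: "term_eq R (TAdd t u) (TAdd u t)"
| add_assoc: "term_eq R (TAdd (TAdd t u) w) (TAdd t (TAdd u w))"
| add_zero: "term_eq R (TAdd t TZero) t"
| add_minus: "term_eq R (TAdd t (TScale (-1) t)) TZero"
| scale_one: "term_eq R (TScale 1 t) t"
| scale_scale: "term_eq R (TScale k (TScale l t)) (TScale (k * l) t)"
| scale_add_right: "term_eq R (TScale k (TAdd t u)) (TAdd (TScale k t) (TScale k u))"
| scale_add_left: "term_eq R (TScale (k + l) t) (TAdd (TScale k t) (TScale l t))"
| mul_assoc: "term_eq R (TMul (TMul t u) w) (TMul t (TMul u w))"
| mul_add_right: "term_eq R (TMul t (TAdd u w)) (TAdd (TMul t u) (TMul t w))"
| mul_add_left: "term_eq R (TMul (TAdd t u) w) (TAdd (TMul t w) (TMul u w))"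
| mul_scale_left: "term_eq R (TMul (TScale k t) u) (TScale k (TMul t u))"
| mul_scale_right: "term_eq R (TMul t (TScale k u)) (TScale k (TMul t u))"

definition term_class ::
  "(('k::field, 'g) alg_term \<times> ('k, 'g) alg_term) set \<Rightarrow> ('k, 'g) alg_term \<Rightarrow> ('k, 'g) alg_term set" where
  "term_class R t = {u. term_eq R t u}"

text \<open>
  Only the classes of terms over \<open>S\<close> are elements of the algebra, although as sets the classes may
  also contain terms with other generators; provided that \<open>R\<close> only mentions generators from \<open>S\<close>,
  this identifies no two terms over \<open>S\<close> that would not be identified otherwise.
\<close>
definition presented_algebra ::
  "'g set \<Rightarrow> (('k::field, 'g) alg_term \<times> ('k, 'g) alg_term) set \<Rightarrow> ('k, ('k, 'g) alg_term set) nalg" where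
  "presented_algebra S R =
    \<lparr> nalg_carrier = {term_class R t | t. term_gens t \<subseteq> S},
      nalg_zero = term_class R TZero,
      nalg_add = (\<lambda>A B. {w. \<exists>t\<in>A. \<exists>u\<in>B. term_eq R (TAdd t u) w}),
      nalg_scale = (\<lambda>k A. {w. \<exists>t\<in>A. term_eq R (TScale k t) w}),
      nalg_mult = (\<lambda>A B. {w. \<exists>t\<in>A. \<exists>u\<in>B. term_eq R (TMul t u) w}) \<rparr>"

lemma term_class_eq_iff: "term_class R t = term_class R u \<longleftrightarrow> term_eq R t u"
  unfolding term_class_def by (auto intro: term_eq.refl term_eq.sym term_eq.trans)

lemma presented_add [simp]:
  "nalg_add (presented_algebra S R) (term_class R t) (term_class R u) = term_class R (TAdd t u)"
  unfolding presented_algebra_def term_class_def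
  by (auto intro: term_eq.refl term_eq.trans term_eq.add_cong)

lemma presented_scale [simp]:
  "nalg_scale (presented_algebra S R) k (term_class R t) = term_class R (TScale k t)"
  unfolding presented_algebra_def term_class_def
  by (auto intro: term_eq.refl term_eq.trans term_eq.scale_cong)

lemma presented_mult [simp]:
  "nalg_mult (presented_algebra S R) (term_class R t) (term_class R u) = term_class R (TMul t u)"
  unfolding presented_algebra_def term_class_def
  by (auto intro: term_eq.refl term_eq.trans term_eq.mul_cong)

lemma presented_zero [simp]: "nalg_zero (presented_algebra S R) = term_class R TZero"
  by (simp add: presented_algebra_def)

lemma presented_carrier_iff:
  "a \<in> nalg_carrier (presented_algebra S R) \<longleftrightarrow> (\<exists>t. a = term_class R t \<and> term_gens t \<subseteq> S)"
  by (auto simp: presented_algebra_def)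

lemma presented_closed [simp]:
  "term_gens t \<subseteq> S \<Longrightarrow> term_class R t \<in> nalg_carrier (presented_algebra S R)"
  by (auto simp: presented_carrier_iff)

lemma presented_carrierE:
  assumes "a \<in> nalg_carrier (presented_algebra S R)"
  obtains t where "a = term_class R t" "term_gens t \<subseteq> S"
  using assms by (auto simp: presented_carrier_iff)

lemma nonunital_algebra_presented: "nonunital_algebra (presented_algebra S R)"
  by unfold_locales
    ((elim presented_carrierE)?; simp add: term_class_eq_iff;
      (rule term_eq.add_comm term_eq.add_assoc term_eq.add_zero term_eq.add_minus
        term_eq.scale_one term_eq.scale_scale term_eq.scale_add_right term_eq.scale_add_left
        term_eq.mul_assoc term_eq.mul_add_right term_eq.mul_add_left
        term_eq.mul_scale_left term_eq.mul_scale_right)?)+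

primrec term_eval :: "('k, 'a) nalg \<Rightarrow> ('g \<Rightarrow> 'a) \<Rightarrow> ('k, 'g) alg_term \<Rightarrow> 'a" where
  "term_eval B p (Gen g) = p g"
| "term_eval B p TZero = nalg_zero B"
| "term_eval B p (TAdd t u) = nalg_add B (term_eval B p t) (term_eval B p u)"
| "term_eval B p (TScale k t) = nalg_scale B k (term_eval B p t)"
| "term_eval B p (TMul t u) = nalg_mult B (term_eval B p t) (term_eval B p u)"

lemma (in nonunital_algebra) term_eval_closed:
  "range p \<subseteq> nalg_carrier A \<Longrightarrow> term_eval A p t \<in> nalg_carrier A"
  by (induction t) (auto simp: zero_closed add_closed scale_closed mult_closed)

lemma (in nonunital_algebra) term_eval_cong:
  assumes "range p \<subseteq> nalg_carrier A"
    and "\<And>t u. (t, u) \<in> R \<Longrightarrow> term_eval A p t = term_eval A p u"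
    and "term_eq R t u"
  shows "term_eval A p t = term_eval A p u"
  using assms(3)
proof induction
  case (add_comm t u)
  show ?case
    using nonunital_algebra.add_comm[OF nonunital_algebra_axioms]
    by (simp add: term_eval_closed[OF assms(1)])
qed (simp_all add: assms(2) term_eval_closed[OF assms(1)] add_assoc add_zero add_minus
      scale_one scale_scale scale_add_right scale_add_left mult_assoc mult_add_right mult_add_left
      mult_scale_left mult_scale_right)

lemma term_eval_restrict:
  "term_gens t \<subseteq> S \<Longrightarrow> (\<And>g. g \<in> S \<Longrightarrow> p g = q g) \<Longrightarrow> term_eval B p t = term_eval B q t"
  by (induction t) auto

theorem presented_algebra_universal:
  fixes B :: "('k::field, 'b) nalg"
  assumes B: "nonunital_algebra B"
    and R: "\<And>t u. (t, u) \<in> R \<Longrightarrow> term_gens t \<subseteq> S \<and> term_gens u \<subseteq> S"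
    and p: "p \<in> S \<rightarrow> nalg_carrier B"
    and rels: "\<And>t u. (t, u) \<in> R \<Longrightarrow> term_eval B p t = term_eval B p u"
  shows "\<exists>h \<in> nalg_hom (presented_algebra S R) B. \<forall>g\<in>S. h (term_class R (Gen g)) = p g"
    and "\<lbrakk>h \<in> nalg_hom (presented_algebra S R) B; h' \<in> nalg_hom (presented_algebra S R) B;
      \<forall>g\<in>S. h (term_class R (Gen g)) = h' (term_class R (Gen g));
      a \<in> nalg_carrier (presented_algebra S R)\<rbrakk> \<Longrightarrow> h a = h' a"
proof -
  interpret B: nonunital_algebra B by fact
  define q where "q = (\<lambda>g. if g \<in> S then p g else nalg_zero B)"
  have q: "range q \<subseteq> nalg_carrier B"
    using p B.zero_closed by (auto simp: q_def)
  have qp: "term_eval B q t = term_eval B p t" if "term_gens t \<subseteq> S" for t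
    using that by (rule term_eval_restrict) (simp add: q_def)
  have ev: "term_eval B q t = term_eval B q u" if "term_eq R t u" for t u
  proof (rule B.term_eval_cong[OF q _ that])
    fix t' u' assume "(t', u') \<in> R"
    then show "term_eval B q t' = term_eval B q u'"
      using R[of t' u'] rels[of t' u'] qp[of t'] qp[of u'] by simp
  qed
  define h where "h = (\<lambda>a. term_eval B q (SOME t. a = term_class R t))"
  have h: "h (term_class R t) = term_eval B q t" for t
  proof -
    have "term_class R t = term_class R (SOME u. term_class R t = term_class R u)"
      by (rule someI) (rule HOL.refl)
    then have "term_eq R t (SOME u. term_class R t = term_class R u)"
      by (simp only: term_class_eq_iff)
    then show ?thesis unfolding h_def by (rule ev[symmetric])
  qed
  have "h \<in> nalg_hom (presented_algebra S R) B"
    unfolding nalg_hom_def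
    using B.term_eval_closed[OF q] by (auto simp: presented_carrier_iff h)
  moreover have "\<forall>g\<in>S. h (term_class R (Gen g)) = p g"
    by (simp add: h q_def)
  ultimately show "\<exists>h \<in> nalg_hom (presented_algebra S R) B. \<forall>g\<in>S. h (term_class R (Gen g)) = p g"
    by blast
next
  interpret B: nonunital_algebra B by fact
  let ?P = "presented_algebra S R"
  assume h: "h \<in> nalg_hom ?P B" and h': "h' \<in> nalg_hom ?P B"
    and eq: "\<forall>g\<in>S. h (term_class R (Gen g)) = h' (term_class R (Gen g))"
    and a: "a \<in> nalg_carrier ?P"
  have zero: "f (term_class R TZero) = nalg_scale B 0 (f (term_class R TZero))"
    if "f \<in> nalg_hom ?P B" for f
  proof -
    have c: "term_class R TZero \<in> nalg_carrier ?P" by simp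
    let ?z = "f (term_class R TZero)"
    have "nalg_scale ?P 0 (term_class R TZero) = term_class R TZero"
    proof -
      have "term_eq R (TScale 0 TZero) TZero"
      proof -
        have "term_eq R (TScale (1 + (-1)) TZero) (TAdd (TScale 1 TZero) (TScale (-1) TZero))"
          by (rule term_eq.scale_add_left)
        moreover have "term_eq R (TAdd (TScale 1 TZero) (TScale (-1) TZero)) (TAdd TZero (TScale (-1) TZero))"
          by (intro term_eq.add_cong term_eq.scale_one term_eq.refl)
        moreover have "term_eq R (TAdd TZero (TScale (-1) TZero)) TZero"
          by (rule term_eq.add_minus)
        ultimately show ?thesis
          unfolding add.right_inverse by (blast intro: term_eq.trans)
      qed
      then show ?thesis by (simp add: term_class_eq_iff)
    qed
    moreover have "f (nalg_scale ?P 0 (term_class R TZero)) = nalg_scale B 0 ?z"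
      using that c unfolding nalg_hom_def by blast
    ultimately show ?thesis by simp
  qed
  have sz: "nalg_scale B 0 b = nalg_zero B" if "b \<in> nalg_carrier B" for b
    using B.scale_add_left[OF that, of 1 "-1"] B.scale_one[OF that] B.add_minus[OF that] by simp
  have clos: "f (term_class R t) \<in> nalg_carrier B" if "f \<in> nalg_hom ?P B" "term_gens t \<subseteq> S" for f t
    using that unfolding nalg_hom_def by (auto simp: presented_carrier_iff Pi_iff)
  have ops: "f (term_class R (TAdd t u)) = nalg_add B (f (term_class R t)) (f (term_class R u))"
    "f (term_class R (TMul t u)) = nalg_mult B (f (term_class R t)) (f (term_class R u))"
    "f (term_class R (TScale k t)) = nalg_scale B k (f (term_class R t))"
    if "f \<in> nalg_hom ?P B" "term_gens t \<subseteq> S" "term_gens u \<subseteq> S" for f t u k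
  proof -
    have c: "term_class R t \<in> nalg_carrier ?P" "term_class R u \<in> nalg_carrier ?P"
      using that by auto
    have "f (nalg_add ?P (term_class R t) (term_class R u)) = nalg_add B (f (term_class R t)) (f (term_class R u))"
      "f (nalg_mult ?P (term_class R t) (term_class R u)) = nalg_mult B (f (term_class R t)) (f (term_class R u))"
      "f (nalg_scale ?P k (term_class R t)) = nalg_scale B k (f (term_class R t))"
      using that(1) c unfolding nalg_hom_def by blast+
    then show "f (term_class R (TAdd t u)) = nalg_add B (f (term_class R t)) (f (term_class R u))"
      "f (term_class R (TMul t u)) = nalg_mult B (f (term_class R t)) (f (term_class R u))"
      "f (term_class R (TScale k t)) = nalg_scale B k (f (term_class R t))"
      by simp_all
  qed
  have "h (term_class R t) = h' (term_class R t)" if "term_gens t \<subseteq> S" for t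
    using that
  proof (induction t)
    case TZero
    show ?case
      using zero[OF h] zero[OF h'] sz clos[OF h, of TZero] clos[OF h', of TZero] by simp
  next
    case (Gen g)
    then show ?case using eq by simp
  next
    case (TAdd t u)
    then show ?case using ops(1)[OF h, of t u] ops(1)[OF h', of t u] by simp
  next
    case (TScale k t)
    then show ?case using ops(3)[OF h, of t t k] ops(3)[OF h', of t t k] by simp
  next
    case (TMul t u)
    then show ?case using ops(2)[OF h, of t u] ops(2)[OF h', of t u] by simp
  qed
  with a show "h a = h' a" by (auto simp: presented_carrier_iff)
qed


section \<open>Leavitt path algebras\<close>

text \<open>
  Graphs are taken from the digraph library, with source map \<open>tail\<close> and range map \<open>head\<close>;
  thus \<open>out_arcs E v\<close> is the set of edges with source \<open>v\<close>.
\<close>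

definition countable_graph :: "('u, 'e) pre_digraph \<Rightarrow> bool" where
  "countable_graph E \<longleftrightarrow> wf_digraph E \<and> countable (verts E) \<and> countable (arcs E)"

definition regular_vertices :: "('u, 'e) pre_digraph \<Rightarrow> 'u set" where
  "regular_vertices E = {v \<in> verts E. finite (out_arcs E v) \<and> out_arcs E v \<noteq> {}}"

definition sinks :: "('u, 'e) pre_digraph \<Rightarrow> 'u set" where
  "sinks E = {v \<in> verts E. out_arcs E v = {}}"

definition infinite_emitters :: "('u, 'e) pre_digraph \<Rightarrow> 'u set" where
  "infinite_emitters E = {v \<in> verts E. infinite (out_arcs E v)}"

datatype ('u, 'e) lpa_gen = Vertex 'u | Edge 'e | Ghost 'e

definition lpa_gens :: "('u, 'e) pre_digraph \<Rightarrow> ('u, 'e) lpa_gen set" where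
  "lpa_gens E = Vertex ` verts E \<union> Edge ` arcs E \<union> Ghost ` arcs E"

text \<open>
  Formal sums are formed along a list; in the last relation \<open>es\<close> ranges over all enumerations of
  the edges with source \<open>v\<close>.
\<close>
inductive_set lpa_rels ::
  "('u, 'e) pre_digraph \<Rightarrow> (('k::field, ('u, 'e) lpa_gen) alg_term \<times> ('k, ('u, 'e) lpa_gen) alg_term) set"
  for E where
  vertex_idem: "v \<in> verts E \<Longrightarrow>
    (TMul (Gen (Vertex v)) (Gen (Vertex v)), Gen (Vertex v)) \<in> lpa_rels E"
| vertex_orth: "v \<in> verts E \<Longrightarrow> w \<in> verts E \<Longrightarrow> v \<noteq> w \<Longrightarrow>
    (TMul (Gen (Vertex v)) (Gen (Vertex w)), TZero) \<in> lpa_rels E"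
| source_edge: "e \<in> arcs E \<Longrightarrow>
    (TMul (Gen (Vertex (tail E e))) (Gen (Edge e)), Gen (Edge e)) \<in> lpa_rels E"
| edge_range: "e \<in> arcs E \<Longrightarrow>
    (TMul (Gen (Edge e)) (Gen (Vertex (head E e))), Gen (Edge e)) \<in> lpa_rels E"
| range_ghost: "e \<in> arcs E \<Longrightarrow>
    (TMul (Gen (Vertex (head E e))) (Gen (Ghost e)), Gen (Ghost e)) \<in> lpa_rels E"
| ghost_source: "e \<in> arcs E \<Longrightarrow>
    (TMul (Gen (Ghost e)) (Gen (Vertex (tail E e))), Gen (Ghost e)) \<in> lpa_rels E"
| ghost_edge_same: "e \<in> arcs E \<Longrightarrow>
    (TMul (Gen (Ghost e)) (Gen (Edge e)), Gen (Vertex (head E e))) \<in> lpa_rels E"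
| ghost_edge_diff: "e \<in> arcs E \<Longrightarrow> f \<in> arcs E \<Longrightarrow> e \<noteq> f \<Longrightarrow>
    (TMul (Gen (Ghost e)) (Gen (Edge f)), TZero) \<in> lpa_rels E"
| vertex_sum: "v \<in> regular_vertices E \<Longrightarrow> distinct es \<Longrightarrow> set es = out_arcs E v \<Longrightarrow>
    (Gen (Vertex v), foldr TAdd (map (\<lambda>e. TMul (Gen (Edge e)) (Gen (Ghost e))) es) TZero) \<in> lpa_rels E"

type_synonym ('k, 'u, 'e) lpa_elem = "('k, ('u, 'e) lpa_gen) alg_term set"

definition lpa :: "('u, 'e) pre_digraph \<Rightarrow> ('k::field, ('k, 'u, 'e) lpa_elem) nalg" where
  "lpa E = presented_algebra (lpa_gens E) (lpa_rels E)"

definition lpa_vertex :: "('u, 'e) pre_digraph \<Rightarrow> 'u \<Rightarrow> ('k::field, 'u, 'e) lpa_elem" where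
  "lpa_vertex E v = term_class (lpa_rels E) (Gen (Vertex v))"

definition lpa_edge :: "('u, 'e) pre_digraph \<Rightarrow> 'e \<Rightarrow> ('k::field, 'u, 'e) lpa_elem" where
  "lpa_edge E e = term_class (lpa_rels E) (Gen (Edge e))"

definition lpa_ghost :: "('u, 'e) pre_digraph \<Rightarrow> 'e \<Rightarrow> ('k::field, 'u, 'e) lpa_elem" where
  "lpa_ghost E e = term_class (lpa_rels E) (Gen (Ghost e))"

lemma lpa_rels_gens:
  assumes "wf_digraph E" "(t, u) \<in> lpa_rels E"
  shows "term_gens t \<subseteq> lpa_gens E \<and> term_gens u \<subseteq> lpa_gens E"
proof -
  interpret wf_digraph E by fact
  have *: "term_gens (foldr TAdd (map (\<lambda>e. TMul (Gen (Edge e)) (Gen (Ghost e))) es) TZero) \<subseteq> lpa_gens E"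
    if "set es \<subseteq> arcs E" for es
    using that by (induction es) (auto simp: lpa_gens_def)
  show ?thesis
    using assms(2)
  proof cases
    case (vertex_sum v es)
    moreover have "set es \<subseteq> arcs E" using vertex_sum by auto
    ultimately show ?thesis using *[of es] by (simp add: lpa_gens_def regular_vertices_def)
  qed (auto simp: lpa_gens_def)
qed


section \<open>Representations\<close>

text \<open>
  \<open>Hom_K(W)\<close> for a subspace \<open>W\<close>; its elements are the linear maps \<open>W \<rightarrow> W\<close>, normalised to be
  \<open>undefined\<close> outside of \<open>W\<close>. For \<open>W = UNIV\<close> these are just the linear maps.
\<close>
definition hom_algebra ::
  "('k::field \<Rightarrow> 'v::ab_group_add \<Rightarrow> 'v) \<Rightarrow> 'v set \<Rightarrow> ('k, 'v \<Rightarrow> 'v) nalg" where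
  "hom_algebra scl W =
    \<lparr> nalg_carrier = {f \<in> W \<rightarrow>\<^sub>E W. (\<forall>x\<in>W. \<forall>y\<in>W. f (x + y) = f x + f y) \<and>
                                   (\<forall>k. \<forall>x\<in>W. f (scl k x) = scl k (f x))},
      nalg_zero = (\<lambda>x\<in>W. 0),
      nalg_add = (\<lambda>f g. \<lambda>x\<in>W. f x + g x),
      nalg_scale = (\<lambda>k f. \<lambda>x\<in>W. scl k (f x)),
      nalg_mult = (\<lambda>f g. compose W f g) \<rparr>"

definition lpa_representation ::
  "('u, 'e) pre_digraph \<Rightarrow> ('k::field \<Rightarrow> 'v::ab_group_add \<Rightarrow> 'v) \<Rightarrow> 'v set \<Rightarrow>
   (('k, 'u, 'e) lpa_elem \<Rightarrow> 'v \<Rightarrow> 'v) \<Rightarrow> bool" where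
  "lpa_representation E scl W \<Phi> \<longleftrightarrow>
     vector_space scl \<and> module.subspace scl W \<and> \<Phi> \<in> nalg_hom (lpa E) (hom_algebra scl W)"

definition equivalent_representations ::
  "('u, 'e) pre_digraph \<Rightarrow>
   ('k::field \<Rightarrow> 'w::ab_group_add \<Rightarrow> 'w) \<Rightarrow> 'w set \<Rightarrow> (('k, 'u, 'e) lpa_elem \<Rightarrow> 'w \<Rightarrow> 'w) \<Rightarrow>
   ('k \<Rightarrow> 'm::ab_group_add \<Rightarrow> 'm) \<Rightarrow> 'm set \<Rightarrow> (('k, 'u, 'e) lpa_elem \<Rightarrow> 'm \<Rightarrow> 'm) \<Rightarrow> bool" where
  "equivalent_representations E scl\<^sub>1 W \<Phi> scl\<^sub>2 M \<pi> \<longleftrightarrow>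
     lpa_representation E scl\<^sub>1 W \<Phi> \<and> lpa_representation E scl\<^sub>2 M \<pi> \<and>
     (\<exists>U. bij_betw U W M \<and>
        (\<forall>x\<in>W. \<forall>y\<in>W. U (x + y) = U x + U y) \<and>
        (\<forall>k. \<forall>x\<in>W. U (scl\<^sub>1 k x) = scl\<^sub>2 k (U x)) \<and>
        (\<forall>a\<in>nalg_carrier (lpa E). \<forall>x\<in>W. U (\<Phi> a x) = \<pi> a (U x)))"


section \<open>Algebraic branching systems\<close>

definition algebraic_branching_system ::
  "('u, 'e) pre_digraph \<Rightarrow> 'x set \<Rightarrow> ('e \<Rightarrow> 'x set) \<Rightarrow> ('u \<Rightarrow> 'x set) \<Rightarrow> ('e \<Rightarrow> 'x \<Rightarrow> 'x) \<Rightarrow> bool" where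
  "algebraic_branching_system E X R D f \<longleftrightarrow>
     (\<forall>e\<in>arcs E. R e \<subseteq> X) \<and> (\<forall>v\<in>verts E. D v \<subseteq> X) \<and>
     disjoint_family_on R (arcs E) \<and> disjoint_family_on D (verts E) \<and>
     (\<forall>e\<in>arcs E. R e \<subseteq> D (tail E e)) \<and>
     (\<forall>v\<in>regular_vertices E. D v = (\<Union>e\<in>out_arcs E v. R e)) \<and>
     (\<forall>e\<in>arcs E. bij_betw (f e) (D (head E e)) (R e))"

definition fun_scale :: "'k::field \<Rightarrow> ('x \<Rightarrow> 'k) \<Rightarrow> 'x \<Rightarrow> 'k" where
  "fun_scale c g = (\<lambda>x. c * g x)"

text \<open>
  Finitely supported functions on a set \<open>X\<close>, represented as total functions that vanish outside
  of \<open>X\<close>; the vector space operations are the pointwise ones.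
\<close>
definition finsupp_functions :: "'x set \<Rightarrow> ('x \<Rightarrow> 'k::field) set" where
  "finsupp_functions X = {g. {x. g x \<noteq> 0} \<subseteq> X \<and> finite {x. g x \<noteq> 0}}"

definition induced_representation ::
  "('u, 'e) pre_digraph \<Rightarrow> 'x set \<Rightarrow> ('e \<Rightarrow> 'x set) \<Rightarrow> ('u \<Rightarrow> 'x set) \<Rightarrow> ('e \<Rightarrow> 'x \<Rightarrow> 'x) \<Rightarrow>
   (('k::field, 'u, 'e) lpa_elem \<Rightarrow> ('x \<Rightarrow> 'k) \<Rightarrow> 'x \<Rightarrow> 'k) \<Rightarrow> bool" where
  "induced_representation E X R D f \<pi> \<longleftrightarrow>
     lpa_representation E fun_scale (finsupp_functions X) \<pi> \<and>
     (\<forall>\<phi>\<in>finsupp_functions X.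
        (\<forall>e\<in>arcs E. \<pi> (lpa_edge E e) \<phi> =
           (\<lambda>x. if x \<in> R e then \<phi> (inv_into (D (head E e)) (f e) x) else 0)) \<and>
        (\<forall>e\<in>arcs E. \<pi> (lpa_ghost E e) \<phi> = (\<lambda>x. if x \<in> D (head E e) then \<phi> (f e x) else 0)) \<and>
        (\<forall>v\<in>verts E. \<pi> (lpa_vertex E v) \<phi> = (\<lambda>x. if x \<in> D v then \<phi> x else 0)))"


section \<open>Subspaces attached to a representation, and adapted bases\<close>

definition vertex_space ::
  "('u, 'e) pre_digraph \<Rightarrow> (('k::field, 'u, 'e) lpa_elem \<Rightarrow> 'v \<Rightarrow> 'v) \<Rightarrow> 'u \<Rightarrow> 'v set" where
  "vertex_space E \<Phi> u = range (\<Phi> (lpa_vertex E u))"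

definition edge_space ::
  "('u, 'e) pre_digraph \<Rightarrow> (('k::field, 'u, 'e) lpa_elem \<Rightarrow> 'v \<Rightarrow> 'v) \<Rightarrow> 'e \<Rightarrow> 'v set" where
  "edge_space E \<Phi> e = range (\<Phi> (lpa_edge E e) \<circ> \<Phi> (lpa_ghost E e))"

text \<open>
  The internal sum of a family of subspaces. It is only applied to the families of vertex spaces
  and of edge spaces with a common source; there the sum is direct by orthogonality of the
  projections \<open>\<Phi> v\<close> and \<open>\<Phi> (e e*)\<close>.
\<close>
definition internal_sum ::
  "('k::field \<Rightarrow> 'v::ab_group_add \<Rightarrow> 'v) \<Rightarrow> 'i set \<Rightarrow> ('i \<Rightarrow> 'v set) \<Rightarrow> 'v set" where
  "internal_sum scl I A = module.span scl (\<Union>i\<in>I. A i)"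

definition total_vertex_space ::
  "('u, 'e) pre_digraph \<Rightarrow> ('k::field \<Rightarrow> 'v::ab_group_add \<Rightarrow> 'v) \<Rightarrow>
   (('k, 'u, 'e) lpa_elem \<Rightarrow> 'v \<Rightarrow> 'v) \<Rightarrow> 'v set" where
  "total_vertex_space E scl \<Phi> = internal_sum scl (verts E) (vertex_space E \<Phi>)"

definition is_direct_sum ::
  "('k::field \<Rightarrow> 'v::ab_group_add \<Rightarrow> 'v) \<Rightarrow> 'v set \<Rightarrow> 'v set \<Rightarrow> 'v set \<Rightarrow> bool" where
  "is_direct_sum scl S A B \<longleftrightarrow>
     module.subspace scl A \<and> module.subspace scl B \<and> A \<inter> B = {0} \<and>
     S = {a + b | a b. a \<in> A \<and> b \<in> B}"

definition family_basis ::
  "('k::field \<Rightarrow> 'v::ab_group_add \<Rightarrow> 'v) \<Rightarrow> ('x \<Rightarrow> 'v) \<Rightarrow> 'x set \<Rightarrow> 'v set \<Rightarrow> bool" where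
  "family_basis scl m I S \<longleftrightarrow>
     inj_on m I \<and> \<not> module.dependent scl (m ` I) \<and> module.span scl (m ` I) = S"

text \<open>
  \<open>VU u\<close> and \<open>VB\<close> are the chosen complements, \<open>IU u\<close> and \<open>IB\<close> the index sets of their bases
  (for \<open>u\<close> an infinite emitter). The values of \<open>R\<close>, \<open>D\<close>, \<open>VU\<close>, \<open>IU\<close> at other arguments are
  irrelevant.
\<close>
definition chosen_complements ::
  "('u, 'e) pre_digraph \<Rightarrow> ('k::field \<Rightarrow> 'v::ab_group_add \<Rightarrow> 'v) \<Rightarrow>
   (('k, 'u, 'e) lpa_elem \<Rightarrow> 'v \<Rightarrow> 'v) \<Rightarrow> ('u \<Rightarrow> 'v set) \<Rightarrow> 'v set \<Rightarrow> bool" where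
  "chosen_complements E scl \<Phi> VU VB \<longleftrightarrow>
     (\<forall>u\<in>infinite_emitters E. is_direct_sum scl (vertex_space E \<Phi> u)
        (internal_sum scl (out_arcs E u) (edge_space E \<Phi>)) (VU u)) \<and>
     is_direct_sum scl UNIV (total_vertex_space E scl \<Phi>) VB"

definition adapted_basis ::
  "('u, 'e) pre_digraph \<Rightarrow> ('k::field \<Rightarrow> 'v::ab_group_add \<Rightarrow> 'v) \<Rightarrow>
   (('k, 'u, 'e) lpa_elem \<Rightarrow> 'v \<Rightarrow> 'v) \<Rightarrow> ('u \<Rightarrow> 'v set) \<Rightarrow> 'v set \<Rightarrow>
   ('e \<Rightarrow> 'x set) \<Rightarrow> ('u \<Rightarrow> 'x set) \<Rightarrow> ('u \<Rightarrow> 'x set) \<Rightarrow> 'x set \<Rightarrow> ('x \<Rightarrow> 'v) \<Rightarrow> bool" where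
  "adapted_basis E scl \<Phi> VU VB R D IU IB m \<longleftrightarrow>
     (\<forall>e\<in>arcs E. family_basis scl m (R e) (edge_space E \<Phi> e)) \<and>
     (\<forall>u\<in>infinite_emitters E. family_basis scl m (IU u) (VU u)) \<and>
     (\<forall>u\<in>sinks E. family_basis scl m (D u) (vertex_space E \<Phi> u)) \<and>
     family_basis scl m IB VB \<and>
     disjoint_family_on R (arcs E) \<and>
     disjoint_family_on IU (infinite_emitters E) \<and>
     disjoint_family_on D (sinks E) \<and>
     (\<forall>e\<in>arcs E. \<forall>u\<in>infinite_emitters E. R e \<inter> IU u = {}) \<and>
     (\<forall>e\<in>arcs E. \<forall>u\<in>sinks E. R e \<inter> D u = {}) \<and>
     (\<forall>u\<in>infinite_emitters E. \<forall>w\<in>sinks E. IU u \<inter> D w = {}) \<and>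
     (\<forall>e\<in>arcs E. R e \<inter> IB = {}) \<and>
     (\<forall>u\<in>infinite_emitters E. IU u \<inter> IB = {}) \<and>
     (\<forall>u\<in>sinks E. D u \<inter> IB = {}) \<and>
     (\<forall>u\<in>regular_vertices E. D u = (\<Union>e\<in>out_arcs E u. R e)) \<and>
     (\<forall>u\<in>infinite_emitters E. D u = (\<Union>e\<in>out_arcs E u. R e) \<union> IU u)"

end

theory Submission
  imports Defs
begin

text \<open>
  The branching system is read off the basis: \<open>\<Phi> e\<close> is injective on \<open>V\<^bsub>r(e)\<^esub>\<close>, so by hypothesis
  it induces a bijection \<open>f\<^sub>e : D\<^bsub>r(e)\<^esub> \<rightarrow> R\<^sub>e\<close> of index sets. The coordinate isomorphism \<open>U\<close> from
  \<open>W\<close> onto the finitely supported functions turns \<open>\<Phi>\<close> into the representation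
  \<open>\<pi> a = U \<circ> \<Phi> a \<circ> U\<^sup>-\<^sup>1\<close>, which is equivalent to \<open>\<Phi>\<close> by construction; since all generators act
  on the basis as partial injections of the index set, \<open>\<pi>\<close> is the induced representation. If \<open>V\<close> has a
  complement of \<open>W\<close> annihilated by all vertices, it has a basis indexed by the same set \<open>IB\<close> as
  the chosen complement, and the same argument applies to the whole of \<open>V\<close>.
\<close>

section \<open>Bases given by indexed families\<close>

text \<open>The sum runs over the support of \<open>\<phi>\<close>, so it is a genuine linear
  combination on \<open>finsupp_functions\<close>; for infinite support the sum takes its default
  value 0.\<close>

definition lin_comb :: "('k::field \<Rightarrow> 'v::ab_group_add \<Rightarrow> 'v) \<Rightarrow> ('x \<Rightarrow> 'v) \<Rightarrow> ('x \<Rightarrow> 'k) \<Rightarrow> 'v" where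
  "lin_comb scl b \<phi> = (\<Sum>x | \<phi> x \<noteq> 0. scl (\<phi> x) (b x))"

context vector_space
begin

text \<open>\<open>b\<close> may repeat vectors, so one index is chosen for each vector occurring in
  an ordinary span representation; on the chosen set \<open>b\<close> is injective and the sum can
  be reindexed.\<close>

lemma span_image_explicit:
  assumes "v \<in> span (b ` I)"
  obtains A c where "finite A" "A \<subseteq> I" "v = (\<Sum>x\<in>A. scale (c x) (b x))"
proof -
  obtain t r where t: "finite t" "t \<subseteq> b ` I" and v: "v = (\<Sum>a\<in>t. scale (r a) a)"
    using assms unfolding span_explicit by auto
  obtain A where A: "A \<subseteq> I" "inj_on b A" "t = b ` A"
    using t(2) by (auto simp: subset_image_inj)
  show thesis
  proof
    show "finite A" using A t finite_imageD by blast
    show "A \<subseteq> I" by fact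
    show "v = (\<Sum>x\<in>A. scale (r (b x)) (b x))"
      unfolding v A(3) by (simp add: sum.reindex[OF A(2)])
  qed
qed

text \<open>Injectivity of \<open>b\<close> together with independence of its image set amounts to
  linear independence of the indexed family: a repetition \<open>b x = b y\<close> would give a
  relation with coefficients 1 and -1. Later independence proofs can thus work with indices
  alone.\<close>

lemma family_basis_iff:
  "family_basis scale b I S \<longleftrightarrow> span (b ` I) = S \<and>
     (\<forall>A c. finite A \<longrightarrow> A \<subseteq> I \<longrightarrow> (\<Sum>x\<in>A. scale (c x) (b x)) = 0 \<longrightarrow> (\<forall>x\<in>A. c x = 0))"
  (is "_ \<longleftrightarrow> _ \<and> ?indep")
proof -
  have "?indep" if inj: "inj_on b I" and ind: "independent (b ` I)"
  proof (intro allI impI ballI)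
    fix A c x
    assume A: "finite A" "A \<subseteq> I" "(\<Sum>x\<in>A. scale (c x) (b x)) = 0" and x: "x \<in> A"
    have injA: "inj_on b A" using inj A(2) by (rule inj_on_subset)
    have "(\<Sum>v\<in>b ` A. scale (c (inv_into A b v)) v) = (\<Sum>x\<in>A. scale (c x) (b x))"
      by (simp add: sum.reindex[OF injA] inv_into_f_f[OF injA])
    with A have "c (inv_into A b (b x)) = 0"
      by (intro independentD[OF ind, of "b ` A" "\<lambda>v. c (inv_into A b v)" "b x"]) (use x in auto)
    then show "c x = 0" by (simp add: inv_into_f_f[OF injA x])
  qed
  moreover have "inj_on b I" if ?indep
  proof (rule inj_onI, rule ccontr)
    fix x y assume xy: "x \<in> I" "y \<in> I" "b x = b y" "x \<noteq> y"
    let ?c = "\<lambda>z. if z = x then 1 else - 1 :: 'a"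
    have "(\<Sum>z\<in>{x, y}. scale (?c z) (b z)) = 0"
      using xy by simp
    then have "?c x = 0"
      using that[rule_format, of "{x, y}" ?c x] xy by simp
    then show False by simp
  qed
  moreover have "independent (b ` I)" if ?indep
    unfolding independent_explicit_module
  proof (intro allI impI)
    fix t u v
    assume t: "finite t" "t \<subseteq> b ` I" "(\<Sum>v\<in>t. scale (u v) v) = 0" "v \<in> t"
    obtain A where A: "A \<subseteq> I" "inj_on b A" "t = b ` A"
      using t(2) by (auto simp: subset_image_inj)
    have "finite A" using A t finite_imageD by blast
    moreover have "(\<Sum>x\<in>A. scale (u (b x)) (b x)) = 0"
      using t(3) unfolding A(3) by (simp add: sum.reindex[OF A(2)])
    ultimately have "\<forall>x\<in>A. u (b x) = 0"
      using that[rule_format, of A "\<lambda>x. u (b x)"] A(1) by blast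
    then show "u v = 0" using t(4) A(3) by auto
  qed
  ultimately show ?thesis unfolding family_basis_def by blast
qed

lemma family_basisI:
  assumes "span (b ` I) = S"
    and "\<And>A c x. \<lbrakk>finite A; A \<subseteq> I; (\<Sum>x\<in>A. scale (c x) (b x)) = 0; x \<in> A\<rbrakk> \<Longrightarrow> c x = 0"
  shows "family_basis scale b I S"
  using assms unfolding family_basis_iff by blast

lemma family_basis_span: "family_basis scale b I S \<Longrightarrow> span (b ` I) = S"
  unfolding family_basis_def by blast

lemma family_basis_mem: "family_basis scale b I S \<Longrightarrow> x \<in> I \<Longrightarrow> b x \<in> S"
  using family_basis_span span_base by blast

lemma family_basis_indep:
  "\<lbrakk>family_basis scale b I S; finite A; A \<subseteq> I; (\<Sum>x\<in>A. scale (c x) (b x)) = 0; x \<in> A\<rbrakk> \<Longrightarrow> c x = 0"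
  unfolding family_basis_iff by blast

text \<open>The maps \<open>P i\<close> serve as orthogonal projections witnessing that the sum of
  the \<open>S i\<close> is direct. Applying \<open>P i\<close> to a vanishing combination deletes
  the terms with index outside \<open>D i\<close> and keeps the others, which leaves a relation
  inside a single basis.\<close>

lemma family_basis_UN:
  assumes fb: "\<And>i. i \<in> I \<Longrightarrow> family_basis scale m (D i) (S i)"
    and lin: "\<And>i. i \<in> I \<Longrightarrow> Vector_Spaces.linear scale scale (P i)"
    and id: "\<And>i y. i \<in> I \<Longrightarrow> y \<in> S i \<Longrightarrow> P i y = y"
    and orth: "\<And>i j y. i \<in> I \<Longrightarrow> j \<in> I \<Longrightarrow> i \<noteq> j \<Longrightarrow> y \<in> S j \<Longrightarrow> P i y = 0"
  shows "family_basis scale m (\<Union>i\<in>I. D i) (span (\<Union>i\<in>I. S i))"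
proof (rule family_basisI)
  show "span (m ` (\<Union>i\<in>I. D i)) = span (\<Union>i\<in>I. S i)"
  proof (rule span_eq[THEN iffD2], intro conjI)
    show "m ` (\<Union>i\<in>I. D i) \<subseteq> span (\<Union>i\<in>I. S i)"
      using family_basis_mem[OF fb] by (blast intro: span_base)
    show "(\<Union>i\<in>I. S i) \<subseteq> span (m ` (\<Union>i\<in>I. D i))"
    proof safe
      fix i y assume "i \<in> I" "y \<in> S i"
      then have "y \<in> span (m ` D i)" using family_basis_span[OF fb] by blast
      also have "\<dots> \<subseteq> span (m ` (\<Union>i\<in>I. D i))" using \<open>i \<in> I\<close> by (intro span_mono) blast
      finally show "y \<in> span (m ` (\<Union>i\<in>I. D i))" .
    qed
  qed
next
  fix A c x
  assume A: "finite A" "A \<subseteq> (\<Union>i\<in>I. D i)" and s: "(\<Sum>x\<in>A. scale (c x) (m x)) = 0" and x: "x \<in> A"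
  obtain i where i: "i \<in> I" "x \<in> D i" using A x by blast
  interpret P: Vector_Spaces.linear scale scale "P i" by (rule lin[OF i(1)])
  have "0 = P i (\<Sum>y\<in>A. scale (c y) (m y))" by (simp add: s P.zero)
  also have "\<dots> = (\<Sum>y\<in>A. scale (c y) (P i (m y)))" by (simp add: P.sum P.scale)
  also have "\<dots> = (\<Sum>y\<in>A \<inter> D i. scale (c y) (m y))"
  proof (rule sum.mono_neutral_cong_right[OF A(1)])
    show "\<forall>y\<in>A - A \<inter> D i. scale (c y) (P i (m y)) = 0"
    proof
      fix y assume y: "y \<in> A - A \<inter> D i"
      then obtain j where j: "j \<in> I" "y \<in> D j" using A by blast
      with y have "i \<noteq> j" by blast
      then show "scale (c y) (P i (m y)) = 0"
        using orth[OF i(1) j(1) _ family_basis_mem[OF fb[OF j(1)] j(2)]] by simp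
    qed
  qed (use id[OF i(1) family_basis_mem[OF fb[OF i(1)]]] in auto)
  finally show "c x = 0"
    using family_basis_indep[OF fb[OF i(1)], of "A \<inter> D i" c x] A x i by auto
qed

lemma is_direct_sumD:
  assumes "is_direct_sum scale S A B"
  shows "subspace A" "subspace B" "A \<inter> B = {0}" "S = {a + b | a b. a \<in> A \<and> b \<in> B}"
  using assms unfolding is_direct_sum_def by auto

text \<open>A vanishing combination splits into a part in \<open>A\<close> and a part in
  \<open>B\<close> that are negatives of each other; both lie in the trivial intersection. The
  family is spliced from two functions because a basis of another complement will later replace
  \<open>m\<close> on \<open>IB\<close>.\<close>

lemma family_basis_Un:
  assumes a: "family_basis scale a I A" and b: "family_basis scale b J B"
    and ds: "is_direct_sum scale S A B" and disj: "I \<inter> J = {}"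
  shows "family_basis scale (\<lambda>x. if x \<in> I then a x else b x) (I \<union> J) S"
    (is "family_basis scale ?m _ _")
proof (rule family_basisI)
  have "?m ` (I \<union> J) = a ` I \<union> b ` J" using disj by force
  then show "span (?m ` (I \<union> J)) = S"
    using is_direct_sumD(4)[OF ds] family_basis_span[OF a] family_basis_span[OF b]
    by (auto simp: span_Un)
next
  fix T c x
  assume T: "finite T" "T \<subseteq> I \<union> J" "(\<Sum>x\<in>T. scale (c x) (?m x)) = 0" and x: "x \<in> T"
  let ?p = "\<Sum>x\<in>T \<inter> I. scale (c x) (a x)" and ?q = "\<Sum>x\<in>T \<inter> J. scale (c x) (b x)"
  have "T = (T \<inter> I) \<union> (T \<inter> J)" using T by blast
  then have "(\<Sum>x\<in>T. scale (c x) (?m x)) =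
      (\<Sum>x\<in>T \<inter> I. scale (c x) (?m x)) + (\<Sum>x\<in>T \<inter> J. scale (c x) (?m x))"
    using T disj by (metis (no_types, lifting) Int_assoc Int_left_commute finite_Int inf_bot_right sum.union_disjoint)
  also have "(\<Sum>x\<in>T \<inter> J. scale (c x) (?m x)) = ?q"
    using disj by (intro sum.cong) auto
  also have "(\<Sum>x\<in>T \<inter> I. scale (c x) (?m x)) = ?p" by (intro sum.cong) auto
  finally have pq: "?p = - ?q" using T(3) by (simp add: add_eq_0_iff)
  have "?p \<in> A"
    using is_direct_sumD(1)[OF ds] family_basis_mem[OF a] by (intro subspace_sum subspace_scale) auto
  moreover have "?q \<in> B"
    using is_direct_sumD(2)[OF ds] family_basis_mem[OF b] by (intro subspace_sum subspace_scale) auto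
  then have "?p \<in> B" using pq is_direct_sumD(2)[OF ds] subspace_neg by auto
  ultimately have "?p = 0" using is_direct_sumD(3)[OF ds] by blast
  with pq have "?q = 0" by simp
  show "c x = 0"
  proof (cases "x \<in> I")
    case True
    with family_basis_indep[OF a, of "T \<inter> I" c x] \<open>?p = 0\<close> T x show ?thesis by auto
  next
    case False
    with family_basis_indep[OF b, of "T \<inter> J" c x] \<open>?q = 0\<close> T x show ?thesis by auto
  qed
qed

text \<open>Both complements are isomorphic to the quotient of \<open>S\<close> by \<open>W\<close>.
  The basis is carried over this isomorphism: \<open>b' x\<close> is an element of \<open>B'\<close>
  congruent to \<open>b x\<close> modulo \<open>W\<close>, so the index set does not change.\<close>

lemma family_basis_other_complement:
  assumes B: "is_direct_sum scale S W B" and B': "is_direct_sum scale S W B'"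
    and b: "family_basis scale b I B"
  obtains b' where "family_basis scale b' I B'"
proof -
  note W = is_direct_sumD(1)[OF B]
  have "\<exists>y\<in>B'. b x - y \<in> W" if "x \<in> I" for x
  proof -
    have "b x \<in> S"
      using family_basis_mem[OF b that] is_direct_sumD(4)[OF B] subspace_0[OF W] by force
    then obtain w y where "w \<in> W" "y \<in> B'" "b x = w + y"
      using is_direct_sumD(4)[OF B'] by blast
    then show ?thesis by force
  qed
  then obtain b' where b': "\<And>x. x \<in> I \<Longrightarrow> b' x \<in> B'" "\<And>x. x \<in> I \<Longrightarrow> b x - b' x \<in> W"
    by metis
  \<comment> \<open>Combinations with the same coefficients in the two families stay congruent
    modulo \<open>W\<close>. Spanning and independence both reduce to this and the trivial
    intersection of \<open>W\<close> with each complement.\<close>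
  have diff: "(\<Sum>x\<in>T. scale (c x) (b x)) - (\<Sum>x\<in>T. scale (c x) (b' x)) \<in> W" if "T \<subseteq> I" for T c
    using b'(2) that
    by (auto simp: sum_subtractf[symmetric] scale_right_diff_distrib[symmetric]
        intro!: subspace_sum[OF W] subspace_scale[OF W])
  have "family_basis scale b' I B'"
  proof (rule family_basisI)
    show "span (b' ` I) = B'"
    proof
      show "span (b' ` I) \<subseteq> B'" using b'(1) is_direct_sumD(2)[OF B'] by (intro span_minimal) auto
      show "B' \<subseteq> span (b' ` I)"
      proof
        fix v assume v: "v \<in> B'"
        then have "v \<in> S" using is_direct_sumD(4)[OF B'] subspace_0[OF W] by force
        then obtain w y where w: "w \<in> W" "y \<in> B" "v = w + y"
          using is_direct_sumD(4)[OF B] by blast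
        then obtain T c where T: "finite T" "T \<subseteq> I" "y = (\<Sum>x\<in>T. scale (c x) (b x))"
          using family_basis_span[OF b] span_image_explicit by metis
        let ?y' = "\<Sum>x\<in>T. scale (c x) (b' x)"
        \<comment> \<open>The difference \<open>v - ?y'\<close> is shown to lie in both
          \<open>W\<close> and \<open>B'\<close>, hence to be 0.\<close>
        have "w + (y - ?y') \<in> W" using diff[OF T(2)] w T(3) by (intro subspace_add[OF W]) auto
        then have "v - ?y' \<in> W" using w(3) by (simp add: algebra_simps)
        moreover have "?y' \<in> B'" using T(2) b'(1)
          by (intro subspace_sum subspace_scale is_direct_sumD(2)[OF B']) auto
        then have "v - ?y' \<in> B'" using v by (intro subspace_diff is_direct_sumD(2)[OF B'])
        ultimately have "v - ?y' = 0" using is_direct_sumD(3)[OF B'] by blast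
        then have "v = ?y'" by simp
        also have "\<dots> \<in> span (b' ` I)" using T(2) by (intro span_sum span_scale span_base) auto
        finally show "v \<in> span (b' ` I)" .
      qed
    qed
  next
    fix T c x
    assume T: "finite T" "T \<subseteq> I" "(\<Sum>x\<in>T. scale (c x) (b' x)) = 0" "x \<in> T"
    have "(\<Sum>x\<in>T. scale (c x) (b x)) \<in> W" using diff[OF T(2), of c] T(3) by simp
    moreover have "(\<Sum>x\<in>T. scale (c x) (b x)) \<in> B"
      using T(2) family_basis_mem[OF b] by (intro subspace_sum subspace_scale is_direct_sumD(2)[OF B]) auto
    ultimately have "(\<Sum>x\<in>T. scale (c x) (b x)) = 0" using is_direct_sumD(3)[OF B] by blast
    then show "c x = 0" using family_basis_indep[OF b] T by blast
  qed
  then show thesis by (rule that)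
qed

section \<open>Coordinates with respect to an indexed basis\<close>

lemma lin_comb_eq:
  "finite A \<Longrightarrow> {x. \<phi> x \<noteq> 0} \<subseteq> A \<Longrightarrow> lin_comb scale b \<phi> = (\<Sum>x\<in>A. scale (\<phi> x) (b x))"
  unfolding lin_comb_def by (rule sum.mono_neutral_left) auto

lemma lin_comb_add:
  assumes "\<phi> \<in> finsupp_functions X" "\<psi> \<in> finsupp_functions X"
  shows "lin_comb scale b (\<phi> + \<psi>) = lin_comb scale b \<phi> + lin_comb scale b \<psi>"
proof -
  let ?A = "{x. \<phi> x \<noteq> 0} \<union> {x. \<psi> x \<noteq> 0}"
  have "finite ?A" using assms by (simp add: finsupp_functions_def)
  moreover have "{x. (\<phi> + \<psi>) x \<noteq> 0} \<subseteq> ?A" by auto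
  ultimately show ?thesis
    by (simp add: lin_comb_eq[of ?A] scale_left_distrib sum.distrib)
qed

lemma lin_comb_scale:
  assumes "\<phi> \<in> finsupp_functions X"
  shows "lin_comb scale b (fun_scale k \<phi>) = scale k (lin_comb scale b \<phi>)"
proof -
  let ?A = "{x. \<phi> x \<noteq> 0}"
  have "finite ?A" using assms by (simp add: finsupp_functions_def)
  moreover have "{x. fun_scale k \<phi> x \<noteq> 0} \<subseteq> ?A" by (auto simp: fun_scale_def)
  ultimately show ?thesis
    by (simp add: lin_comb_eq[of ?A] scale_sum_right fun_scale_def)
qed

text \<open>Injectivity is independence applied to the difference of two coordinate functions on the
  union of their supports; surjectivity extends the coefficients of a finite combination by
  0.\<close>

lemma lin_comb_bij:
  assumes b: "family_basis scale b I S"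
  shows "bij_betw (lin_comb scale b) (finsupp_functions I) S"
  unfolding bij_betw_def
proof
  show "inj_on (lin_comb scale b) (finsupp_functions I)"
  proof (rule inj_onI, rule ext)
    fix \<phi> \<psi> x
    assume \<phi>: "\<phi> \<in> finsupp_functions I" and \<psi>: "\<psi> \<in> finsupp_functions I"
      and eq: "lin_comb scale b \<phi> = lin_comb scale b \<psi>"
    let ?A = "{x. \<phi> x \<noteq> 0} \<union> {x. \<psi> x \<noteq> 0}"
    have A: "finite ?A" "?A \<subseteq> I" using \<phi> \<psi> by (auto simp: finsupp_functions_def)
    have "(\<Sum>x\<in>?A. scale (\<phi> x - \<psi> x) (b x)) = 0"
      using eq A by (simp add: lin_comb_eq[of ?A] scale_left_diff_distrib sum_subtractf)
    then have "\<phi> x - \<psi> x = 0" if "x \<in> ?A"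
      using family_basis_indep[OF b A _ that, where c = "\<lambda>x. \<phi> x - \<psi> x"] by simp
    then show "\<phi> x = \<psi> x" by (cases "x \<in> ?A") auto
  qed
  show "lin_comb scale b ` finsupp_functions I = S"
  proof safe
    fix \<phi> :: "'c \<Rightarrow> 'a" assume "\<phi> \<in> finsupp_functions I"
    then have "{x. \<phi> x \<noteq> 0} \<subseteq> I" by (simp add: finsupp_functions_def)
    then show "lin_comb scale b \<phi> \<in> S"
      unfolding lin_comb_def family_basis_span[OF b, symmetric]
      by (intro span_sum span_scale span_base) auto
  next
    fix v assume "v \<in> S"
    then obtain A c where A: "finite A" "A \<subseteq> I" and v: "v = (\<Sum>x\<in>A. scale (c x) (b x))"
      using family_basis_span[OF b] span_image_explicit by metis
    let ?c = "\<lambda>x. if x \<in> A then c x else 0"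
    have supp: "{x. ?c x \<noteq> 0} \<subseteq> A" by auto
    then have "?c \<in> finsupp_functions I"
      using A by (auto simp: finsupp_functions_def intro: finite_subset)
    moreover have "v = lin_comb scale b ?c" by (simp add: v lin_comb_eq[OF A(1) supp])
    ultimately show "v \<in> lin_comb scale b ` finsupp_functions I" by blast
  qed
qed

text \<open>A single statement for the three kinds of generators of the Leavitt path algebra: each of
  them acts on the basis as a partial injection \<open>g\<close> of the index set.\<close>
lemma lin_comb_partial_injection:
  assumes L: "Vector_Spaces.linear scale scale L" and g: "bij_betw g P Q" and PQ: "Q \<subseteq> Y"
    and on: "\<And>x. x \<in> P \<Longrightarrow> L (b x) = b (g x)"
    and off: "\<And>x. x \<in> Y - P \<Longrightarrow> L (b x) = 0"
    and \<phi>: "\<phi> \<in> finsupp_functions Y"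
  defines "\<psi> \<equiv> (\<lambda>y. if y \<in> Q then \<phi> (inv_into P g y) else 0)"
  shows "\<psi> \<in> finsupp_functions Y" and "L (lin_comb scale b \<phi>) = lin_comb scale b \<psi>"
proof -
  interpret L: Vector_Spaces.linear scale scale L by fact
  let ?A = "{x. \<phi> x \<noteq> 0}"
  have A: "finite ?A" "?A \<subseteq> Y" using \<phi> by (auto simp: finsupp_functions_def)
  have inj: "inj_on g P" and im: "g ` P = Q" using g by (auto simp: bij_betw_def)
  \<comment> \<open>This bound supplies the finite set over which the transported sum is reindexed,
    and also makes the support of \<open>\<psi>\<close> finite.\<close>
  have supp: "{y. \<psi> y \<noteq> 0} \<subseteq> g ` (?A \<inter> P)"
  proof
    fix y assume "y \<in> {y. \<psi> y \<noteq> 0}"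
    then have "y \<in> Q" "\<phi> (inv_into P g y) \<noteq> 0" by (auto simp: \<psi>_def split: if_splits)
    then show "y \<in> g ` (?A \<inter> P)"
      using im by (intro image_eqI[of _ _ "inv_into P g y"]) (auto simp: f_inv_into_f inv_into_into)
  qed
  have fin: "finite (g ` (?A \<inter> P))" using A by simp
  then show "\<psi> \<in> finsupp_functions Y"
    using supp im PQ by (auto simp: finsupp_functions_def intro: finite_subset)
  have "L (lin_comb scale b \<phi>) = (\<Sum>x\<in>?A. scale (\<phi> x) (L (b x)))"
    by (simp add: lin_comb_def L.sum L.scale)
  \<comment> \<open>Terms with index outside \<open>P\<close> vanish by \<open>off\<close>.\<close>
  also have "\<dots> = (\<Sum>x\<in>?A \<inter> P. scale (\<phi> x) (b (g x)))"
    using A off on by (intro sum.mono_neutral_cong_right) auto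
  also have "\<dots> = (\<Sum>x\<in>?A \<inter> P. scale (\<psi> (g x)) (b (g x)))"
    using inj im by (intro sum.cong) (auto simp: \<psi>_def inv_into_f_f)
  also have "\<dots> = (\<Sum>y\<in>g ` (?A \<inter> P). scale (\<psi> y) (b y))"
    using inj by (subst sum.reindex) (auto intro: inj_on_subset)
  also have "\<dots> = lin_comb scale b \<psi>" by (rule lin_comb_eq[OF fin supp, symmetric])
  finally show "L (lin_comb scale b \<phi>) = lin_comb scale b \<psi>" .
qed

end

section \<open>The vector space of finitely supported functions\<close>

lemma vector_space_fun_scale: "vector_space (fun_scale :: 'k::field \<Rightarrow> ('x \<Rightarrow> 'k) \<Rightarrow> 'x \<Rightarrow> 'k)"
  by unfold_locales (auto simp: fun_scale_def algebra_simps)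

lemma subspace_finsupp_functions:
  "module.subspace fun_scale (finsupp_functions X :: ('x \<Rightarrow> 'k::field) set)"
proof -
  interpret vector_space "fun_scale :: 'k \<Rightarrow> ('x \<Rightarrow> 'k) \<Rightarrow> 'x \<Rightarrow> 'k"
    by (rule vector_space_fun_scale)
  show ?thesis
  proof (rule subspaceI)
    fix \<phi> \<psi> :: "'x \<Rightarrow> 'k"
    assume "\<phi> \<in> finsupp_functions X" "\<psi> \<in> finsupp_functions X"
    moreover have "{x. (\<phi> + \<psi>) x \<noteq> 0} \<subseteq> {x. \<phi> x \<noteq> 0} \<union> {x. \<psi> x \<noteq> 0}" by auto
    ultimately show "\<phi> + \<psi> \<in> finsupp_functions X"
      unfolding finsupp_functions_def by (blast intro: finite_subset)
  next
    fix k and \<phi> :: "'x \<Rightarrow> 'k"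
    assume "\<phi> \<in> finsupp_functions X"
    moreover have "{x. fun_scale k \<phi> x \<noteq> 0} \<subseteq> {x. \<phi> x \<noteq> 0}" by (auto simp: fun_scale_def)
    ultimately show "fun_scale k \<phi> \<in> finsupp_functions X"
      unfolding finsupp_functions_def by (blast intro: finite_subset)
  qed (simp add: finsupp_functions_def)
qed

section \<open>Representations described pointwise, their restriction and transport\<close>

lemma hom_algebra_simps [simp]:
  "nalg_add (hom_algebra scl W) f g = (\<lambda>x\<in>W. f x + g x)"
  "nalg_scale (hom_algebra scl W) k f = (\<lambda>x\<in>W. scl k (f x))"
  "nalg_mult (hom_algebra scl W) f g = compose W f g"
  by (simp_all add: hom_algebra_def)

lemma hom_algebra_carrier_iff:
  "f \<in> nalg_carrier (hom_algebra scl W) \<longleftrightarrow> f \<in> W \<rightarrow>\<^sub>E W \<and>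
     (\<forall>x\<in>W. \<forall>y\<in>W. f (x + y) = f x + f y) \<and> (\<forall>k. \<forall>x\<in>W. f (scl k x) = scl k (f x))"
  by (simp add: hom_algebra_def)

lemma nonunital_algebra_lpa: "nonunital_algebra (lpa E)"
  unfolding lpa_def by (rule nonunital_algebra_presented)

lemma lpa_representation_ops:
  fixes a b :: "('k::field, 'u, 'e) lpa_elem"
  assumes "lpa_representation E scl S \<Psi>" and "a \<in> nalg_carrier (lpa E)"
  shows "\<Psi> a \<in> S \<rightarrow>\<^sub>E S"
    and "x \<in> S \<Longrightarrow> y \<in> S \<Longrightarrow> \<Psi> a (x + y) = \<Psi> a x + \<Psi> a y"
    and "x \<in> S \<Longrightarrow> \<Psi> a (scl k x) = scl k (\<Psi> a x)"
    and "x \<in> S \<Longrightarrow> \<Psi> (nalg_scale (lpa E) k a) x = scl k (\<Psi> a x)"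
    and "b \<in> nalg_carrier (lpa E) \<Longrightarrow> x \<in> S \<Longrightarrow> \<Psi> (nalg_add (lpa E) a b) x = \<Psi> a x + \<Psi> b x"
    and "b \<in> nalg_carrier (lpa E) \<Longrightarrow> x \<in> S \<Longrightarrow> \<Psi> (nalg_mult (lpa E) a b) x = \<Psi> a (\<Psi> b x)"
proof -
  have h: "\<Psi> \<in> nalg_hom (lpa E) (hom_algebra scl S)"
    using assms(1) by (simp add: lpa_representation_def)
  then have "\<Psi> a \<in> nalg_carrier (hom_algebra scl S)"
    using assms(2) by (auto simp: nalg_hom_def)
  then show "\<Psi> a \<in> S \<rightarrow>\<^sub>E S"
    and "x \<in> S \<Longrightarrow> y \<in> S \<Longrightarrow> \<Psi> a (x + y) = \<Psi> a x + \<Psi> a y"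
    and "x \<in> S \<Longrightarrow> \<Psi> a (scl k x) = scl k (\<Psi> a x)"
    by (auto simp: hom_algebra_carrier_iff)
  show "x \<in> S \<Longrightarrow> \<Psi> (nalg_scale (lpa E) k a) x = scl k (\<Psi> a x)"
    and "b \<in> nalg_carrier (lpa E) \<Longrightarrow> x \<in> S \<Longrightarrow> \<Psi> (nalg_add (lpa E) a b) x = \<Psi> a x + \<Psi> b x"
    and "b \<in> nalg_carrier (lpa E) \<Longrightarrow> x \<in> S \<Longrightarrow> \<Psi> (nalg_mult (lpa E) a b) x = \<Psi> a (\<Psi> b x)"
    using h assms(2) by (auto simp: nalg_hom_def compose_def)
qed

lemma lpa_representationI:
  fixes scl :: "'k::field \<Rightarrow> 'v::ab_group_add \<Rightarrow> 'v"
    and \<Psi> :: "('k, 'u, 'e) lpa_elem \<Rightarrow> 'v \<Rightarrow> 'v"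
  assumes "vector_space scl" "module.subspace scl S"
    and maps: "\<And>a. a \<in> nalg_carrier (lpa E) \<Longrightarrow> \<Psi> a \<in> S \<rightarrow>\<^sub>E S"
    and "\<And>a x y. a \<in> nalg_carrier (lpa E) \<Longrightarrow> x \<in> S \<Longrightarrow> y \<in> S \<Longrightarrow> \<Psi> a (x + y) = \<Psi> a x + \<Psi> a y"
    and "\<And>a k x. a \<in> nalg_carrier (lpa E) \<Longrightarrow> x \<in> S \<Longrightarrow> \<Psi> a (scl k x) = scl k (\<Psi> a x)"
    and sc: "\<And>a k x. a \<in> nalg_carrier (lpa E) \<Longrightarrow> x \<in> S \<Longrightarrow> \<Psi> (nalg_scale (lpa E) k a) x = scl k (\<Psi> a x)"
    and ad: "\<And>a b x. a \<in> nalg_carrier (lpa E) \<Longrightarrow> b \<in> nalg_carrier (lpa E) \<Longrightarrow> x \<in> S \<Longrightarrow>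
      \<Psi> (nalg_add (lpa E) a b) x = \<Psi> a x + \<Psi> b x"
    and mu: "\<And>a b x. a \<in> nalg_carrier (lpa E) \<Longrightarrow> b \<in> nalg_carrier (lpa E) \<Longrightarrow> x \<in> S \<Longrightarrow>
      \<Psi> (nalg_mult (lpa E) a b) x = \<Psi> a (\<Psi> b x)"
  shows "lpa_representation E scl S \<Psi>"
proof -
  interpret L: nonunital_algebra "lpa E" by (rule nonunital_algebra_lpa)
  \<comment> \<open>Elements of \<open>hom_algebra\<close> are \<open>undefined\<close> off
    \<open>S\<close>, so equality of two of them is decided on \<open>S\<close>.\<close>
  have ext: "f = restrict g S" if "f \<in> S \<rightarrow>\<^sub>E S" "\<And>x. x \<in> S \<Longrightarrow> f x = g x" for f g :: "'v \<Rightarrow> 'v"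
    using that by (auto simp: restrict_def PiE_def extensional_def)
  have "\<Psi> \<in> nalg_hom (lpa E) (hom_algebra scl S)"
    unfolding nalg_hom_def mem_Collect_eq hom_algebra_simps compose_def
  proof (intro conjI ballI allI)
    show "\<Psi> \<in> nalg_carrier (lpa E) \<rightarrow> nalg_carrier (hom_algebra scl S)"
      using assms(3-5) by (auto simp: hom_algebra_carrier_iff)
  next
    fix a b :: "('k, 'u, 'e) lpa_elem"
    assume a: "a \<in> nalg_carrier (lpa E)" and b: "b \<in> nalg_carrier (lpa E)"
    show "\<Psi> (nalg_add (lpa E) a b) = (\<lambda>x\<in>S. \<Psi> a x + \<Psi> b x)"
      by (rule ext[OF maps[OF L.add_closed[OF a b]] ad[OF a b]])
    show "\<Psi> (nalg_mult (lpa E) a b) = (\<lambda>x\<in>S. \<Psi> a (\<Psi> b x))"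
      by (rule ext[OF maps[OF L.mult_closed[OF a b]] mu[OF a b]])
  next
    fix k and a :: "('k, 'u, 'e) lpa_elem"
    assume a: "a \<in> nalg_carrier (lpa E)"
    show "\<Psi> (nalg_scale (lpa E) k a) = (\<lambda>x\<in>S. scl k (\<Psi> a x))"
      by (rule ext[OF maps[OF L.scale_closed[OF a]] sc[OF a]])
  qed
  then show ?thesis using assms(1,2) by (simp add: lpa_representation_def)
qed

lemma lpa_representation_restrict:
  assumes rep: "lpa_representation E scl UNIV \<Phi>" and S: "module.subspace scl S"
    and inv: "\<And>a x. a \<in> nalg_carrier (lpa E) \<Longrightarrow> x \<in> S \<Longrightarrow> \<Phi> a x \<in> S"
  shows "lpa_representation E scl S (\<lambda>a. restrict (\<Phi> a) S)"
proof -
  interpret vector_space scl using rep by (simp add: lpa_representation_def)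
  note ops = lpa_representation_ops[OF rep, simplified]
  show ?thesis
    by (rule lpa_representationI[OF vector_space_axioms S])
      (auto simp: inv ops subspace_add[OF S] subspace_scale[OF S])
qed

text \<open>Conjugation by a linear bijection preserves all algebra operations, and the inverse of
  \<open>T\<close> is the intertwiner. \<open>T\<close> points from the model to \<open>S\<close>
  because it will be \<open>lin_comb\<close>, which has an explicit formula while the coordinate map
  has none.\<close>

lemma lpa_representation_transport:
  fixes T :: "'m::ab_group_add \<Rightarrow> 'v::ab_group_add" and \<Psi> :: "('k::field, 'u, 'e) lpa_elem \<Rightarrow> 'v \<Rightarrow> 'v"
  assumes rep: "lpa_representation E scl S \<Psi>"
    and scl': "vector_space scl'" and M: "module.subspace scl' M"
    and bij: "bij_betw T M S"
    and add: "\<And>x y. x \<in> M \<Longrightarrow> y \<in> M \<Longrightarrow> T (x + y) = T x + T y"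
    and scale: "\<And>k x. x \<in> M \<Longrightarrow> T (scl' k x) = scl k (T x)"
  shows "equivalent_representations E scl S \<Psi> scl' M (\<lambda>a. \<lambda>x\<in>M. inv_into M T (\<Psi> a (T x)))"
proof -
  interpret M: vector_space scl' by fact
  note ops = lpa_representation_ops[OF rep]
  let ?U = "inv_into M T"
  have TM: "T x \<in> S" if "x \<in> M" for x using bij that by (auto simp: bij_betw_def)
  have UM: "?U y \<in> M" and TU: "T (?U y) = y" if "y \<in> S" for y
    using bij that by (auto simp: bij_betw_def inv_into_into f_inv_into_f)
  have UT: "?U (T x) = x" if "x \<in> M" for x using bij that by (auto simp: bij_betw_def)
  have \<Psi>S: "\<Psi> a y \<in> S" if "a \<in> nalg_carrier (lpa E)" "y \<in> S" for a y
    using ops(1)[OF that(1)] that(2) by auto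
  \<comment> \<open>Linearity of the inverse comes from applying \<open>?U\<close> to the
    \<open>T\<close>-image of a sum, respectively a multiple, of preimages.\<close>
  have Uadd: "?U (x + y) = ?U x + ?U y" if "x \<in> S" "y \<in> S" for x y
    using UT[OF M.subspace_add[OF M UM[OF that(1)] UM[OF that(2)]]] that by (simp add: add UM TU)
  have Uscale: "?U (scl k x) = scl' k (?U x)" if "x \<in> S" for k x
    using UT[OF M.subspace_scale[OF M UM[OF that]]] that by (simp add: scale UM TU)
  have "lpa_representation E scl' M (\<lambda>a. \<lambda>x\<in>M. ?U (\<Psi> a (T x)))"
    by (rule lpa_representationI[OF scl' M])
      (auto simp: add scale ops TM \<Psi>S UM TU Uadd Uscale M.subspace_add[OF M] M.subspace_scale[OF M])
  moreover have "bij_betw ?U S M" by (rule bij_betw_inv_into[OF bij])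
  ultimately show ?thesis
    unfolding equivalent_representations_def using rep UM TU Uadd Uscale
    by (intro conjI exI[of _ ?U]) auto
qed

section \<open>The generators as operators satisfying the Leavitt relations\<close>

locale lpa_module = vector_space scl
  for scl :: "'k::field \<Rightarrow> 'v::ab_group_add \<Rightarrow> 'v" +
  fixes E :: "('u, 'e) pre_digraph" and \<Phi> :: "('k, 'u, 'e) lpa_elem \<Rightarrow> 'v \<Rightarrow> 'v"
  assumes rep: "lpa_representation E scl UNIV \<Phi>" and wf: "wf_digraph E"
begin

sublocale wf_digraph E by (rule wf)

abbreviation "PV u \<equiv> \<Phi> (lpa_vertex E u)"
abbreviation "PE e \<equiv> \<Phi> (lpa_edge E e)"
abbreviation "PG e \<equiv> \<Phi> (lpa_ghost E e)"
abbreviation "ev t \<equiv> \<Phi> (term_class (lpa_rels E) t)"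

lemma class_carrier: "term_gens t \<subseteq> lpa_gens E \<Longrightarrow> term_class (lpa_rels E) t \<in> nalg_carrier (lpa E)"
  by (simp add: lpa_def)

lemma generator_carrier:
  "u \<in> verts E \<Longrightarrow> lpa_vertex E u \<in> nalg_carrier (lpa E)"
  "e \<in> arcs E \<Longrightarrow> lpa_edge E e \<in> nalg_carrier (lpa E)"
  "e \<in> arcs E \<Longrightarrow> lpa_ghost E e \<in> nalg_carrier (lpa E)"
  unfolding lpa_vertex_def lpa_edge_def lpa_ghost_def by (auto intro!: class_carrier simp: lpa_gens_def)

lemma linear_rep: "a \<in> nalg_carrier (lpa E) \<Longrightarrow> Vector_Spaces.linear scl scl (\<Phi> a)"
  using lpa_representation_ops(2,3)[OF rep] by unfold_locales auto

lemmas linear_generator = generator_carrier[THEN linear_rep]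

lemma rep_zero: "a \<in> nalg_carrier (lpa E) \<Longrightarrow> \<Phi> a 0 = 0"
  using lpa_representation_ops(2)[OF rep, of a 0 0] by simp

lemmas generator_zero [simp] = generator_carrier[THEN rep_zero]

lemma ev_simps:
  "term_gens t \<subseteq> lpa_gens E \<Longrightarrow> term_gens u \<subseteq> lpa_gens E \<Longrightarrow> ev (TAdd t u) x = ev t x + ev u x"
  "term_gens t \<subseteq> lpa_gens E \<Longrightarrow> term_gens u \<subseteq> lpa_gens E \<Longrightarrow> ev (TMul t u) x = ev t (ev u x)"
  "term_gens t \<subseteq> lpa_gens E \<Longrightarrow> ev (TScale k t) x = scl k (ev t x)"
  using lpa_representation_ops(4)[OF rep class_carrier, of t x k]
    lpa_representation_ops(5,6)[OF rep class_carrier class_carrier, of t u x]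
  by (auto simp: lpa_def)

lemma ev_cong: "term_eq (lpa_rels E) t u \<Longrightarrow> ev t = ev u"
  using term_class_eq_iff by metis

text \<open>Preservation of zero is not among the clauses of \<open>nalg_hom\<close>; it follows
  because 0 + 0 = 0 holds between terms and \<open>ev\<close> is additive.\<close>

lemma ev_zero: "ev TZero x = 0"
  using ev_cong[OF term_eq.add_zero[of _ TZero], THEN fun_cong, of x]
  by (simp add: ev_simps)

lemma ev_rel: "(t, u) \<in> lpa_rels E \<Longrightarrow> ev t x = ev u x"
  using ev_cong[OF term_eq.rel] by metis

lemma ev_generator:
  "ev (Gen (Vertex u)) = PV u" "ev (Gen (Edge e)) = PE e" "ev (Gen (Ghost e)) = PG e"
  by (simp_all add: lpa_vertex_def lpa_edge_def lpa_ghost_def)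

lemma relations:
  "u \<in> verts E \<Longrightarrow> PV u (PV u x) = PV u x"
  "u \<in> verts E \<Longrightarrow> w \<in> verts E \<Longrightarrow> u \<noteq> w \<Longrightarrow> PV u (PV w x) = 0"
  "e \<in> arcs E \<Longrightarrow> PV (tail E e) (PE e x) = PE e x"
  "e \<in> arcs E \<Longrightarrow> PE e (PV (head E e) x) = PE e x"
  "e \<in> arcs E \<Longrightarrow> PV (head E e) (PG e x) = PG e x"
  "e \<in> arcs E \<Longrightarrow> PG e (PV (tail E e) x) = PG e x"
  "e \<in> arcs E \<Longrightarrow> PG e (PE e x) = PV (head E e) x"
  "e \<in> arcs E \<Longrightarrow> f \<in> arcs E \<Longrightarrow> e \<noteq> f \<Longrightarrow> PG e (PE f x) = 0"
proof -
  note ev = ev_simps ev_generator ev_zero lpa_gens_def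
  show "u \<in> verts E \<Longrightarrow> PV u (PV u x) = PV u x"
    using ev_rel[OF lpa_rels.vertex_idem[of u E], of x] by (simp add: ev)
  show "u \<in> verts E \<Longrightarrow> w \<in> verts E \<Longrightarrow> u \<noteq> w \<Longrightarrow> PV u (PV w x) = 0"
    using ev_rel[OF lpa_rels.vertex_orth[of u E w], of x] by (simp add: ev)
  show "e \<in> arcs E \<Longrightarrow> PV (tail E e) (PE e x) = PE e x"
    using ev_rel[OF lpa_rels.source_edge[of e E], of x] by (simp add: ev)
  show "e \<in> arcs E \<Longrightarrow> PE e (PV (head E e) x) = PE e x"
    using ev_rel[OF lpa_rels.edge_range[of e E], of x] by (simp add: ev)
  show "e \<in> arcs E \<Longrightarrow> PV (head E e) (PG e x) = PG e x"
    using ev_rel[OF lpa_rels.range_ghost[of e E], of x] by (simp add: ev)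
  show "e \<in> arcs E \<Longrightarrow> PG e (PV (tail E e) x) = PG e x"
    using ev_rel[OF lpa_rels.ghost_source[of e E], of x] by (simp add: ev)
  show "e \<in> arcs E \<Longrightarrow> PG e (PE e x) = PV (head E e) x"
    using ev_rel[OF lpa_rels.ghost_edge_same[of e E], of x] by (simp add: ev)
  show "e \<in> arcs E \<Longrightarrow> f \<in> arcs E \<Longrightarrow> e \<noteq> f \<Longrightarrow> PG e (PE f x) = 0"
    using ev_rel[OF lpa_rels.ghost_edge_diff[of e E f], of x] by (simp add: ev)
qed

text \<open>The presentation states this relation as a formal fold along an enumeration of the
  edges. Induction on the list evaluates the fold, and distinctness turns the list sum into a set
  sum.\<close>

lemma vertex_sum:
  assumes u: "u \<in> regular_vertices E"
  shows "PV u x = (\<Sum>e\<in>out_arcs E u. PE e (PG e x))"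
proof -
  have "finite (out_arcs E u)" using u by (simp add: regular_vertices_def)
  then obtain es where es: "set es = out_arcs E u" "distinct es"
    using finite_distinct_list by blast
  let ?t = "\<lambda>es. foldr TAdd (map (\<lambda>e. TMul (Gen (Edge e)) (Gen (Ghost e))) es) TZero"
  have gens: "term_gens (?t fs) \<subseteq> lpa_gens E" if "set fs \<subseteq> arcs E" for fs
    using that by (induction fs) (auto simp: lpa_gens_def)
  have "ev (?t fs) x = (\<Sum>e\<leftarrow>fs. PE e (PG e x))" if "set fs \<subseteq> arcs E" for fs
    using that
  proof (induction fs)
    case (Cons e fs)
    have "ev (?t (e # fs)) x = ev (TMul (Gen (Edge e)) (Gen (Ghost e))) x + ev (?t fs) x"
      unfolding list.map foldr.simps o_apply
      using gens[of fs] Cons.prems by (intro ev_simps(1)) (auto simp: lpa_gens_def)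
    with Cons show ?case by (simp add: ev_simps(2) ev_generator lpa_gens_def)
  qed (simp add: ev_zero)
  moreover have "set es \<subseteq> arcs E" using es by auto
  ultimately show ?thesis
    using ev_rel[OF lpa_rels.vertex_sum[OF u es(2,1)], of x] es
    by (simp add: ev_generator sum_list_distinct_conv_sum_set)
qed

text \<open>This makes the total vertex space invariant, so that \<open>\<Phi>\<close> restricts to
  it. Each generator absorbs a vertex on its left, hence has its range in a vertex space; the range
  of a product lies in that of its left factor, and the span is closed under sums and
  multiples.\<close>

lemma rep_range_total_vertex_space:
  assumes "a \<in> nalg_carrier (lpa E)"
  shows "\<Phi> a x \<in> total_vertex_space E scl \<Phi>"
proof -
  let ?W = "total_vertex_space E scl \<Phi>"
  have W: "subspace ?W" unfolding total_vertex_space_def internal_sum_def by simp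
  have V: "PV u y \<in> ?W" if "u \<in> verts E" for u y
    unfolding total_vertex_space_def internal_sum_def vertex_space_def
    using that by (intro span_base) auto
  have "ev t x \<in> ?W" if "term_gens t \<subseteq> lpa_gens E" for t
    using that
  proof (induction t arbitrary: x)
    case (Gen g)
    then show ?case
    proof (cases g)
      case (Vertex u)
      with Gen show ?thesis using V[of u x] by (auto simp: lpa_gens_def ev_generator)
    next
      case (Edge e)
      with Gen show ?thesis using V[of "tail E e" "PE e x"]
        by (auto simp: lpa_gens_def ev_generator relations)
    next
      case (Ghost e)
      with Gen show ?thesis using V[of "head E e" "PG e x"]
        by (auto simp: lpa_gens_def ev_generator relations)
    qed
  qed (auto simp: ev_zero ev_simps subspace_0[OF W] subspace_add[OF W] subspace_scale[OF W])
  then show ?thesis using assms by (auto simp: lpa_def presented_carrier_iff)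
qed

section \<open>From a permuted basis to an induced representation\<close>

text \<open>Both claims of the theorem are instances. Conjugating by \<open>lin_comb\<close> gives
  an equivalent \<open>\<pi>\<close>; the formulas for \<open>\<pi>\<close> on generators then
  follow from their action on basis vectors as partial injections of the index set.\<close>

lemma branching_representation:
  fixes b :: "'x \<Rightarrow> 'v"
  assumes S: "subspace S" and inv: "\<And>a x. a \<in> nalg_carrier (lpa E) \<Longrightarrow> x \<in> S \<Longrightarrow> \<Phi> a x \<in> S"
    and fb: "family_basis scl b Y S" and abs: "algebraic_branching_system E Y R D f"
    and vertex_on: "\<And>u x. u \<in> verts E \<Longrightarrow> x \<in> D u \<Longrightarrow> PV u (b x) = b x"
    and vertex_off: "\<And>u x. u \<in> verts E \<Longrightarrow> x \<in> Y - D u \<Longrightarrow> PV u (b x) = 0"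
    and edge_on: "\<And>e x. e \<in> arcs E \<Longrightarrow> x \<in> D (head E e) \<Longrightarrow> PE e (b x) = b (f e x)"
    and ghost_off: "\<And>e x. e \<in> arcs E \<Longrightarrow> x \<in> Y - R e \<Longrightarrow> PG e (b x) = 0"
  shows "\<exists>\<pi>. induced_representation E Y R D f \<pi> \<and>
    equivalent_representations E scl S (\<lambda>a. restrict (\<Phi> a) S) fun_scale (finsupp_functions Y) \<pi>"
proof -
  let ?T = "lin_comb scl b"
  let ?M = "finsupp_functions Y :: ('x \<Rightarrow> 'k) set"
  define \<pi> where "\<pi> = (\<lambda>a. \<lambda>\<phi>\<in>?M. inv_into ?M ?T (restrict (\<Phi> a) S (?T \<phi>)))"
  note bij = lin_comb_bij[OF fb]
  have "lpa_representation E scl S (\<lambda>a. restrict (\<Phi> a) S)"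
    by (rule lpa_representation_restrict[OF rep S]) (fact inv)
  then have equiv: "equivalent_representations E scl S (\<lambda>a. restrict (\<Phi> a) S) fun_scale ?M \<pi>"
    unfolding \<pi>_def
    by (rule lpa_representation_transport[OF _ vector_space_fun_scale subspace_finsupp_functions bij])
      (erule (1) lin_comb_add, erule lin_comb_scale)
  \<comment> \<open>Since \<open>?T\<close> is injective, \<open>\<pi> a \<phi>\<close> is found by
    exhibiting a function whose combination equals \<open>\<Phi> a (?T \<phi>)\<close>.\<close>
  have \<pi>: "\<pi> a \<phi> = \<psi>" if "\<phi> \<in> ?M" "\<psi> \<in> ?M" "\<Phi> a (?T \<phi>) = ?T \<psi>" for a \<phi> \<psi>
    using that bij by (auto simp: \<pi>_def bij_betw_def)
  have D: "D u \<subseteq> Y" if "u \<in> verts E" for u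
    using abs that by (auto simp: algebraic_branching_system_def)
  have R: "R e \<subseteq> Y" and f: "bij_betw (f e) (D (head E e)) (R e)" if "e \<in> arcs E" for e
    using abs that by (auto simp: algebraic_branching_system_def)
  \<comment> \<open>An edge absorbs its range vertex on the right, and that vertex annihilates
    \<open>b x\<close>.\<close>
  have edge_off: "PE e (b x) = 0" if "e \<in> arcs E" "x \<in> Y - D (head E e)" for e x
    using relations(4)[of e "b x"] vertex_off[of "head E e" x] that by simp
  \<comment> \<open>A ghost edge undoes its edge: their product is the range vertex, which fixes
    \<open>b x\<close> for \<open>x\<close> in \<open>D (head E e)\<close>.\<close>
  have ghost_on: "PG e (b y) = b (inv_into (D (head E e)) (f e) y)" if "e \<in> arcs E" "y \<in> R e" for e y
  proof -
    define x where "x = inv_into (D (head E e)) (f e) y"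
    have "x \<in> D (head E e)" "f e x = y"
      using f[OF that(1)] that(2) by (auto simp: x_def bij_betw_def inv_into_into f_inv_into_f)
    then show ?thesis
      using edge_on[of e x] relations(7)[of e "b x"] vertex_on[of "head E e" x] that(1)
      by (simp flip: x_def)
  qed
  have "induced_representation E Y R D f \<pi>"
    unfolding induced_representation_def
  proof (intro conjI ballI)
    show "lpa_representation E fun_scale ?M \<pi>"
      using equiv by (simp add: equivalent_representations_def)
  next
    fix \<phi> e assume \<phi>: "\<phi> \<in> ?M" and e: "e \<in> arcs E"
    show "\<pi> (lpa_edge E e) \<phi> = (\<lambda>x. if x \<in> R e then \<phi> (inv_into (D (head E e)) (f e) x) else 0)"
      using lin_comb_partial_injection[where b = b and g = "f e", OF linear_generator(2)[OF e] f[OF e] R[OF e]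
          edge_on[OF e] edge_off[OF e] \<phi>] by (intro \<pi>[OF \<phi>]) auto
  next
    fix \<phi> e assume \<phi>: "\<phi> \<in> ?M" and e: "e \<in> arcs E"
    note g = bij_betw_inv_into[OF f[OF e]]
    \<comment> \<open>The partial injection of the ghost edge is the inverse of \<open>f e\<close>,
      so the inverse occurring in the pushed-forward coefficients is \<open>f e\<close>
      itself.\<close>
    have "inv_into (R e) (inv_into (D (head E e)) (f e)) x = f e x" if "x \<in> D (head E e)" for x
      using f[OF e] that by (intro inv_into_f_eq) (auto simp: bij_betw_def inj_on_inv_into)
    then have "(\<lambda>x. if x \<in> D (head E e) then \<phi> (f e x) else 0) =
        (\<lambda>x. if x \<in> D (head E e) then \<phi> (inv_into (R e) (inv_into (D (head E e)) (f e)) x) else 0)"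
      by auto
    with lin_comb_partial_injection[where b = b and g = "inv_into (D (head E e)) (f e)",
          OF linear_generator(3)[OF e] g D[OF head_in_verts[OF e]]
          ghost_on[OF e] ghost_off[OF e] \<phi>]
    show "\<pi> (lpa_ghost E e) \<phi> = (\<lambda>x. if x \<in> D (head E e) then \<phi> (f e x) else 0)"
      by (intro \<pi>[OF \<phi>]) simp_all
  next
    fix \<phi> u assume \<phi>: "\<phi> \<in> ?M" and u: "u \<in> verts E"
    \<comment> \<open>A vertex acts through the identity on \<open>D u\<close>.\<close>
    have "inv_into (D u) (\<lambda>x. x) x = x" if "x \<in> D u" for x
      using that by (intro inv_into_f_eq) auto
    then have "(\<lambda>x. if x \<in> D u then \<phi> x else 0) =
        (\<lambda>x. if x \<in> D u then \<phi> (inv_into (D u) (\<lambda>x. x) x) else 0)"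
      by auto
    with lin_comb_partial_injection[OF linear_generator(1)[OF u] _ D[OF u] _ _ \<phi>,
        of "\<lambda>x. x" "D u" b] vertex_on[OF u] vertex_off[OF u]
    show "\<pi> (lpa_vertex E u) \<phi> = (\<lambda>x. if x \<in> D u then \<phi> x else 0)"
      by (intro \<pi>[OF \<phi>]) (simp_all add: bij_betw_def)
  qed
  with equiv show ?thesis by blast
qed

section \<open>Vertex spaces and edge spaces\<close>

lemma PV_vertex_space: "u \<in> verts E \<Longrightarrow> y \<in> vertex_space E \<Phi> u \<Longrightarrow> PV u y = y"
  by (auto simp: vertex_space_def relations)

lemma PV_other_vertex_space:
  "u \<in> verts E \<Longrightarrow> w \<in> verts E \<Longrightarrow> u \<noteq> w \<Longrightarrow> y \<in> vertex_space E \<Phi> w \<Longrightarrow> PV u y = 0"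
  by (auto simp: vertex_space_def relations)

lemma edge_space_subset: "e \<in> arcs E \<Longrightarrow> edge_space E \<Phi> e \<subseteq> vertex_space E \<Phi> (tail E e)"
  unfolding edge_space_def vertex_space_def using relations(3)[of e]
  by (auto simp: image_iff) metis

lemma PE_PG_edge_space: "e \<in> arcs E \<Longrightarrow> y \<in> edge_space E \<Phi> e \<Longrightarrow> PE e (PG e y) = y"
  by (auto simp: edge_space_def relations)

lemma PG_other_edge_space:
  "e \<in> arcs E \<Longrightarrow> f \<in> arcs E \<Longrightarrow> e \<noteq> f \<Longrightarrow> y \<in> edge_space E \<Phi> f \<Longrightarrow> PG e y = 0"
  by (auto simp: edge_space_def relations)

lemma subspace_vertex_space: "u \<in> verts E \<Longrightarrow> subspace (vertex_space E \<Phi> u)"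
proof -
  assume "u \<in> verts E"
  then interpret P: Vector_Spaces.linear scl scl "PV u" by (rule linear_generator(1))
  show ?thesis unfolding vertex_space_def by (rule P.subspace_image[OF subspace_UNIV])
qed

text \<open>The relation \<open>vertex_sum\<close> splits a vector of the vertex space into its edge
  components; conversely an edge absorbs its source vertex on the left.\<close>

lemma vertex_space_regular:
  assumes u: "u \<in> regular_vertices E"
  shows "vertex_space E \<Phi> u = internal_sum scl (out_arcs E u) (edge_space E \<Phi>)"
proof
  have uv: "u \<in> verts E" using u by (simp add: regular_vertices_def)
  show "vertex_space E \<Phi> u \<subseteq> internal_sum scl (out_arcs E u) (edge_space E \<Phi>)"
    unfolding internal_sum_def
  proof
    fix y assume "y \<in> vertex_space E \<Phi> u"
    then have "y = (\<Sum>e\<in>out_arcs E u. PE e (PG e y))"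
      using vertex_sum[OF u, of y] PV_vertex_space[OF uv] by simp
    moreover have "PE e (PG e y) \<in> edge_space E \<Phi> e" for e by (auto simp: edge_space_def)
    then have "(\<Sum>e\<in>out_arcs E u. PE e (PG e y)) \<in> span (\<Union>e\<in>out_arcs E u. edge_space E \<Phi> e)"
      by (intro span_sum span_base) blast
    ultimately show "y \<in> span (\<Union>e\<in>out_arcs E u. edge_space E \<Phi> e)" by simp
  qed
  show "internal_sum scl (out_arcs E u) (edge_space E \<Phi>) \<subseteq> vertex_space E \<Phi> u"
    unfolding internal_sum_def using edge_space_subset
    by (intro span_minimal subspace_vertex_space[OF uv]) fastforce
qed

end

section \<open>Bases and index sets of the vertex spaces\<close>

locale adapted_lpa_module = lpa_module scl E \<Phi>
  for scl :: "'k::field \<Rightarrow> 'v::ab_group_add \<Rightarrow> 'v"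
    and E :: "('u, 'e) pre_digraph" and \<Phi> :: "('k, 'u, 'e) lpa_elem \<Rightarrow> 'v \<Rightarrow> 'v" +
  fixes VU :: "'u \<Rightarrow> 'v set" and VB :: "'v set"
    and R :: "'e \<Rightarrow> 'x set" and D IU :: "'u \<Rightarrow> 'x set" and IB :: "'x set"
    and m :: "'x \<Rightarrow> 'v"
  assumes complements: "chosen_complements E scl \<Phi> VU VB"
    and basis: "adapted_basis E scl \<Phi> VU VB R D IU IB m"
    and permutes: "\<And>e. e \<in> arcs E \<Longrightarrow> PE e ` (m ` D (head E e)) = m ` R e"
    and kills: "\<And>e w. e \<in> arcs E \<Longrightarrow> infinite (out_arcs E (tail E e)) \<Longrightarrow> w \<in> VU (tail E e) \<Longrightarrow> PG e w = 0"
begin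

abbreviation "X \<equiv> \<Union>u\<in>verts E. D u"
abbreviation "W \<equiv> total_vertex_space E scl \<Phi>"

lemma vertex_cases:
  assumes "u \<in> verts E"
  obtains "u \<in> sinks E" | "u \<in> regular_vertices E" | "u \<in> infinite_emitters E"
  using assms unfolding sinks_def regular_vertices_def infinite_emitters_def by blast

lemma basis_edge: "e \<in> arcs E \<Longrightarrow> family_basis scl m (R e) (edge_space E \<Phi> e)"
  and basis_infinite: "u \<in> infinite_emitters E \<Longrightarrow> family_basis scl m (IU u) (VU u)"
  and basis_sink: "u \<in> sinks E \<Longrightarrow> family_basis scl m (D u) (vertex_space E \<Phi> u)"
  and basis_rest: "family_basis scl m IB VB"
  and D_regular: "u \<in> regular_vertices E \<Longrightarrow> D u = (\<Union>e\<in>out_arcs E u. R e)"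
  and D_infinite: "u \<in> infinite_emitters E \<Longrightarrow> D u = (\<Union>e\<in>out_arcs E u. R e) \<union> IU u"
  and R_disjoint: "disjoint_family_on R (arcs E)"
  and R_IU_disjoint: "e \<in> arcs E \<Longrightarrow> u \<in> infinite_emitters E \<Longrightarrow> R e \<inter> IU u = {}"
  and IU_disjoint: "disjoint_family_on IU (infinite_emitters E)"
  and D_sinks_disjoint: "disjoint_family_on D (sinks E)"
  and R_D_sink_disjoint: "e \<in> arcs E \<Longrightarrow> w \<in> sinks E \<Longrightarrow> R e \<inter> D w = {}"
  and IU_D_sink_disjoint: "u \<in> infinite_emitters E \<Longrightarrow> w \<in> sinks E \<Longrightarrow> IU u \<inter> D w = {}"
  and R_IB_disjoint: "e \<in> arcs E \<Longrightarrow> R e \<inter> IB = {}"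
  and IU_IB_disjoint: "u \<in> infinite_emitters E \<Longrightarrow> IU u \<inter> IB = {}"
  and D_sink_IB_disjoint: "u \<in> sinks E \<Longrightarrow> D u \<inter> IB = {}"
  using basis by (simp_all add: adapted_basis_def)

text \<open>Disjointness is given for the building blocks only: \<open>R e\<close>,
  \<open>IU u\<close>, and \<open>D u\<close> at sinks. Since \<open>D\<close> is assembled
  differently at each kind of vertex, the proof runs through the kinds of both vertices.\<close>

lemma D_disjoint: "disjoint_family_on D (verts E)"
  unfolding disjoint_family_on_def
proof (intro ballI impI)
  fix u w assume u: "u \<in> verts E" and w: "w \<in> verts E" and ne: "u \<noteq> w"
  \<comment> \<open>Edges with different sources are different.\<close>
  have RR: "R e \<inter> R f = {}" if "e \<in> out_arcs E u" "f \<in> out_arcs E w" for e f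
  proof -
    have "e \<noteq> f" using that ne by auto
    then show ?thesis using R_disjoint that unfolding disjoint_family_on_def by simp
  qed
  have ss: "u \<in> sinks E \<Longrightarrow> w \<in> sinks E \<Longrightarrow> D u \<inter> D w = {}"
    and ii: "u \<in> infinite_emitters E \<Longrightarrow> w \<in> infinite_emitters E \<Longrightarrow> IU u \<inter> IU w = {}"
    using IU_disjoint D_sinks_disjoint ne unfolding disjoint_family_on_def by simp_all
  have arcs: "\<And>e v. e \<in> out_arcs E v \<Longrightarrow> e \<in> arcs E" by simp
  from u show "D u \<inter> D w = {}"
  proof (cases rule: vertex_cases)
    case 1
    from w show ?thesis
    proof (cases rule: vertex_cases)
      assume "w \<in> sinks E" with 1 show ?thesis by (rule ss)
    next
      assume "w \<in> regular_vertices E"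
      then show ?thesis using R_D_sink_disjoint[OF arcs 1] by (fastforce simp: D_regular)
    next
      assume w: "w \<in> infinite_emitters E"
      then show ?thesis using R_D_sink_disjoint[OF arcs 1] IU_D_sink_disjoint[OF w 1]
        by (fastforce simp: D_infinite)
    qed
  next
    case 2
    from w show ?thesis
    proof (cases rule: vertex_cases)
      assume "w \<in> sinks E"
      then show ?thesis using R_D_sink_disjoint[OF arcs] by (fastforce simp: D_regular[OF 2])
    next
      assume w: "w \<in> regular_vertices E"
      show ?thesis using RR unfolding D_regular[OF 2] D_regular[OF w] by blast
    next
      assume w: "w \<in> infinite_emitters E"
      show ?thesis using RR R_IU_disjoint[OF arcs w] unfolding D_regular[OF 2] D_infinite[OF w] by blast
    qed
  next
    case 3
    from w show ?thesis
    proof (cases rule: vertex_cases)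
      assume "w \<in> sinks E"
      then show ?thesis using R_D_sink_disjoint[OF arcs] IU_D_sink_disjoint[OF 3]
        by (fastforce simp: D_infinite[OF 3])
    next
      assume w: "w \<in> regular_vertices E"
      show ?thesis using RR R_IU_disjoint[OF arcs 3] unfolding D_infinite[OF 3] D_regular[OF w] by blast
    next
      assume w: "w \<in> infinite_emitters E"
      show ?thesis using RR ii[OF 3 w] R_IU_disjoint[OF arcs 3] R_IU_disjoint[OF arcs w]
        unfolding D_infinite[OF 3] D_infinite[OF w] by blast
    qed
  qed
qed

lemma X_IB_disjoint: "X \<inter> IB = {}"
proof -
  have "D u \<inter> IB = {}" if "u \<in> verts E" for u
    using that
  proof (cases rule: vertex_cases)
    case 1
    then show ?thesis by (rule D_sink_IB_disjoint)
  next
    case 2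
    then show ?thesis using R_IB_disjoint by (fastforce simp: D_regular)
  next
    case 3
    then show ?thesis using R_IB_disjoint IU_IB_disjoint by (fastforce simp: D_infinite)
  qed
  then show ?thesis by blast
qed

text \<open>An edge followed after its ghost edge is the required projection: it fixes its own edge
  space and kills the others, as the ghost edge annihilates every other edge.\<close>

lemma basis_edges:
  "family_basis scl m (\<Union>e\<in>out_arcs E u. R e) (internal_sum scl (out_arcs E u) (edge_space E \<Phi>))"
  unfolding internal_sum_def
proof (rule family_basis_UN[where P = "\<lambda>e. PE e \<circ> PG e"])
  fix e assume "e \<in> out_arcs E u"
  then have e: "e \<in> arcs E" by simp
  show "family_basis scl m (R e) (edge_space E \<Phi> e)" by (rule basis_edge[OF e])
  show "Vector_Spaces.linear scl scl (PE e \<circ> PG e)"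
    by (rule Vector_Spaces.linear_compose[OF linear_generator(3)[OF e] linear_generator(2)[OF e]])
  show "(PE e \<circ> PG e) y = y" if "y \<in> edge_space E \<Phi> e" for y
    using PE_PG_edge_space[OF e that] by simp
  show "(PE e \<circ> PG e) y = 0" if "f \<in> out_arcs E u" "e \<noteq> f" "y \<in> edge_space E \<Phi> f" for f y
    using PG_other_edge_space[OF e _ that(2,3)] that(1) e by simp
qed

lemma basis_vertex:
  assumes "u \<in> verts E"
  shows "family_basis scl m (D u) (vertex_space E \<Phi> u)"
  using assms
proof (cases rule: vertex_cases)
  case 1
  then show ?thesis by (rule basis_sink)
next
  case 2
  then show ?thesis using basis_edges by (simp add: D_regular vertex_space_regular)
next
  case 3
  then have "is_direct_sum scl (vertex_space E \<Phi> u)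
      (internal_sum scl (out_arcs E u) (edge_space E \<Phi>)) (VU u)"
    using complements by (simp add: chosen_complements_def)
  moreover have "(\<Union>e\<in>out_arcs E u. R e) \<inter> IU u = {}" using R_IU_disjoint[OF _ 3] by fastforce
  \<comment> \<open>Both families are \<open>m\<close> here, so the spliced family collapses to
    \<open>m\<close>.\<close>
  ultimately show ?thesis
    using family_basis_Un[OF basis_edges basis_infinite[OF 3]] by (simp add: D_infinite[OF 3])
qed

lemma basis_total: "family_basis scl m X W"
  unfolding total_vertex_space_def internal_sum_def
  by (rule family_basis_UN[where P = PV, OF basis_vertex linear_generator(1) PV_vertex_space
        PV_other_vertex_space])

lemma PV_on: "u \<in> verts E \<Longrightarrow> x \<in> D u \<Longrightarrow> PV u (m x) = m x"
  using PV_vertex_space family_basis_mem[OF basis_vertex] by blast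

lemma PV_off: "u \<in> verts E \<Longrightarrow> x \<in> X - D u \<Longrightarrow> PV u (m x) = 0"
  using PV_other_vertex_space family_basis_mem[OF basis_vertex] by blast

lemma R_subset_D:
  assumes e: "e \<in> arcs E"
  shows "R e \<subseteq> D (tail E e)"
proof -
  have out: "e \<in> out_arcs E (tail E e)" using e by simp
  from tail_in_verts[OF e] show ?thesis
  proof (cases rule: vertex_cases)
    case 1
    with out show ?thesis unfolding sinks_def by blast
  next
    case 2
    then show ?thesis using D_regular[OF 2] out by blast
  next
    case 3
    then show ?thesis using D_infinite[OF 3] out by blast
  qed
qed

text \<open>A ghost edge absorbs its source vertex on the right, which disposes of vectors with
  index outside \<open>D (tail E e)\<close>. Inside, the vector lies in another edge space or in the
  complement at an infinite emitter, where \<open>kills\<close> applies.\<close>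

lemma PG_off:
  assumes e: "e \<in> arcs E" and x: "x \<in> X - R e"
  shows "PG e (m x) = 0"
proof (cases "x \<in> D (tail E e)")
  case False
  then show ?thesis
    using relations(6)[OF e, of "m x"] PV_off[of "tail E e" x] e x by simp
next
  case True
  have other: ?thesis if "f \<in> out_arcs E (tail E e)" "x \<in> R f" for f
    using PG_other_edge_space[OF e, of f "m x"] family_basis_mem[OF basis_edge, of f x] that x e by auto
  from tail_in_verts[OF e] show ?thesis
  proof (cases rule: vertex_cases)
    case 1
    then show ?thesis using e by (auto simp: sinks_def)
  next
    case 2
    then show ?thesis using True other by (auto simp: D_regular)
  next
    case 3
    then show ?thesis
      using True other kills[OF e] family_basis_mem[OF basis_infinite[OF 3], of x]
      by (auto simp: D_infinite infinite_emitters_def)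
  qed
qed

section \<open>The branching system read off the basis\<close>

definition f :: "'e \<Rightarrow> 'x \<Rightarrow> 'x" where
  "f e x = inv_into (R e) m (PE e (m x))"

text \<open>By \<open>permutes\<close>, \<open>PE e (m x)\<close> is a basis vector with index in
  \<open>R e\<close>, so the \<open>inv_into\<close> in \<open>f\<close> returns a genuine
  index.\<close>

lemma f_on:
  assumes "e \<in> arcs E" "x \<in> D (head E e)"
  shows "f e x \<in> R e" "m (f e x) = PE e (m x)"
proof -
  have "PE e (m x) \<in> m ` R e" using permutes[OF assms(1)] assms(2) by blast
  then show "f e x \<in> R e" "m (f e x) = PE e (m x)"
    by (auto simp only: f_def inv_into_into f_inv_into_f)
qed

text \<open>The ghost edge gives injectivity: it recovers \<open>m x\<close> from
  \<open>PE e (m x)\<close>, and \<open>m\<close> is injective on \<open>D (head E e)\<close>.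
  Surjectivity is the other inclusion of \<open>permutes\<close>.\<close>

lemma f_bij:
  assumes e: "e \<in> arcs E"
  shows "bij_betw (f e) (D (head E e)) (R e)"
proof (rule bij_betw_imageI)
  have inj: "inj_on m (D (head E e))" "inj_on m (R e)"
    using basis_vertex[OF head_in_verts[OF e]] basis_edge[OF e] by (auto simp: family_basis_def)
  show "inj_on (f e) (D (head E e))"
  proof (rule inj_onI)
    fix x y assume x: "x \<in> D (head E e)" and y: "y \<in> D (head E e)" and "f e x = f e y"
    then have "PG e (PE e (m x)) = PG e (PE e (m y))"
      using f_on(2)[OF e] by metis
    then have "m x = m y" using PV_on x y e by (simp add: relations)
    then show "x = y" using inj(1) x y by (auto dest: inj_onD)
  qed
  show "f e ` D (head E e) = R e"
  proof
    show "f e ` D (head E e) \<subseteq> R e" using f_on(1)[OF e] by blast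
    show "R e \<subseteq> f e ` D (head E e)"
    proof
      fix y assume y: "y \<in> R e"
      then have "m y \<in> PE e ` (m ` D (head E e))" using permutes[OF e] by blast
      then obtain x where x: "x \<in> D (head E e)" "m y = PE e (m x)" by blast
      then have "f e x = y" using inj(2) y by (simp add: f_def flip: x(2))
      then show "y \<in> f e ` D (head E e)" using x by blast
    qed
  qed
qed

text \<open>The ambient set is left open so that one system serves both claims: adjoining
  \<open>IB\<close> adds points that lie in no \<open>D u\<close>.\<close>

lemma branching_system:
  assumes "X \<subseteq> Y"
  shows "algebraic_branching_system E Y R D f"
  unfolding algebraic_branching_system_def
proof (intro conjI ballI)
  show "R e \<subseteq> Y" if "e \<in> arcs E" for e
    using R_subset_D[OF that] tail_in_verts[OF that] assms by blast
qed (use assms R_disjoint D_disjoint R_subset_D D_regular f_bij in auto)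

section \<open>Representations on the total vertex space and on the whole space\<close>

lemma total_branching_representation:
  "\<exists>\<pi>. induced_representation E X R D f \<pi> \<and>
    equivalent_representations E scl W (\<lambda>a. restrict (\<Phi> a) W) fun_scale (finsupp_functions X) \<pi>"
proof (rule branching_representation[where b = m])
  show "subspace W" by (simp add: total_vertex_space_def internal_sum_def)
qed (use rep_range_total_vertex_space basis_total branching_system PV_on PV_off f_on(2) PG_off in auto)

text \<open>The vertices are known to annihilate \<open>VB'\<close>, which may differ from
  \<open>VB\<close>; the basis on \<open>IB\<close> is therefore exchanged for one of
  \<open>VB'\<close>, while \<open>m\<close> is kept on \<open>X\<close>.\<close>

lemma full_branching_representation:
  assumes VB': "is_direct_sum scl UNIV W VB'"
    and zero: "\<And>u w. u \<in> verts E \<Longrightarrow> w \<in> VB' \<Longrightarrow> PV u w = 0"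
  shows "\<exists>\<pi>. induced_representation E (X \<union> IB) R D f \<pi> \<and>
    equivalent_representations E scl UNIV \<Phi> fun_scale (finsupp_functions (X \<union> IB)) \<pi>"
proof -
  obtain m' where m': "family_basis scl m' IB VB'"
    using family_basis_other_complement[OF _ VB' basis_rest] complements
    by (auto simp: chosen_complements_def)
  define b where "b = (\<lambda>x. if x \<in> X then m x else m' x)"
  have b: "family_basis scl b (X \<union> IB) UNIV"
    unfolding b_def by (rule family_basis_Un[OF basis_total m' VB' X_IB_disjoint])
  have bX: "b x = m x" if "x \<in> X" for x using that by (simp add: b_def)
  have bIB: "b x \<in> VB'" if "x \<in> (X \<union> IB) - X" for x
    using that family_basis_mem[OF m'] unfolding b_def by auto
  have "\<exists>\<pi>. induced_representation E (X \<union> IB) R D f \<pi> \<and>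
    equivalent_representations E scl UNIV (\<lambda>a. restrict (\<Phi> a) UNIV) fun_scale (finsupp_functions (X \<union> IB)) \<pi>"
  proof (rule branching_representation[OF subspace_UNIV UNIV_I b])
    show "algebraic_branching_system E (X \<union> IB) R D f" by (rule branching_system) blast
  next
    fix u x assume u: "u \<in> verts E" and x: "x \<in> D u"
    then have "b x = m x" by (intro bX) blast
    then show "PV u (b x) = b x" using PV_on[OF u x] by simp
  next
    fix u x assume u: "u \<in> verts E" and x: "x \<in> X \<union> IB - D u"
    show "PV u (b x) = 0"
    proof (cases "x \<in> X")
      case True
      then show ?thesis using PV_off[OF u, of x] bX[OF True] x by auto
    next
      case False
      then show ?thesis using zero[OF u bIB] x by auto
    qed
  next
    fix e x assume e: "e \<in> arcs E" and x: "x \<in> D (head E e)"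
    \<comment> \<open>Edges map \<open>X\<close> into \<open>X\<close>, where \<open>b\<close>
      agrees with \<open>m\<close>.\<close>
    then have "f e x \<in> X" using f_on(1) R_subset_D tail_in_verts by blast
    moreover have "x \<in> X" using x head_in_verts[OF e] by blast
    ultimately show "PE e (b x) = b (f e x)" using f_on(2)[OF e x] bX by simp
  next
    fix e x assume e: "e \<in> arcs E" and x: "x \<in> X \<union> IB - R e"
    show "PG e (b x) = 0"
    proof (cases "x \<in> X")
      case True
      then show ?thesis using PG_off[OF e, of x] bX[OF True] x by auto
    next
      case False
      \<comment> \<open>On \<open>VB'\<close> a ghost edge vanishes because it absorbs its source
        vertex.\<close>
      then have "PV (tail E e) (b x) = 0" using zero[OF tail_in_verts[OF e] bIB] x by auto
      then show ?thesis using relations(6)[OF e, of "b x"] e by simp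
    qed
  qed
  \<comment> \<open>Restriction to \<open>UNIV\<close> leaves each operator unchanged.\<close>
  then show ?thesis by (simp add: restrict_def)
qed

end

theorem theorem5p3:
  fixes E :: "('u, 'e) pre_digraph"
    and scl :: "'k::field \<Rightarrow> 'v::ab_group_add \<Rightarrow> 'v"
    and \<Phi> :: "('k, 'u, 'e) lpa_elem \<Rightarrow> 'v \<Rightarrow> 'v"
    and VU :: "'u \<Rightarrow> 'v set" and VB :: "'v set"
    and R :: "'e \<Rightarrow> 'x set" and D IU :: "'u \<Rightarrow> 'x set" and IB :: "'x set"
    and m :: "'x \<Rightarrow> 'v"
  assumes graph: "countable_graph E"
    and V: "vector_space scl"
    and rep: "lpa_representation E scl UNIV \<Phi>"
    and complements: "chosen_complements E scl \<Phi> VU VB"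
    and basis: "adapted_basis E scl \<Phi> VU VB R D IU IB m"
    and permutes: "\<forall>e\<in>arcs E. \<Phi> (lpa_edge E e) ` (m ` D (head E e)) = m ` R e"
    and kills: "\<forall>e\<in>arcs E. infinite (out_arcs E (tail E e)) \<longrightarrow>
                  (\<forall>w\<in>VU (tail E e). \<Phi> (lpa_ghost E e) w = 0)"
  shows
    "(\<exists>R' D' f \<pi>.
        algebraic_branching_system E (\<Union>u\<in>verts E. D u) R' D' f \<and>
        induced_representation E (\<Union>u\<in>verts E. D u) R' D' f \<pi> \<and>
        equivalent_representations E
          scl (total_vertex_space E scl \<Phi>) (\<lambda>a. restrict (\<Phi> a) (total_vertex_space E scl \<Phi>))
          fun_scale (finsupp_functions (\<Union>u\<in>verts E. D u)) \<pi>)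
     \<and> ((\<exists>VB'. is_direct_sum scl UNIV (total_vertex_space E scl \<Phi>) VB' \<and>
               (\<forall>u\<in>verts E. \<forall>w\<in>VB'. \<Phi> (lpa_vertex E u) w = 0)) \<longrightarrow>
        (\<exists>R' D' f \<pi>.
           algebraic_branching_system E ((\<Union>u\<in>verts E. D u) \<union> IB) R' D' f \<and>
           induced_representation E ((\<Union>u\<in>verts E. D u) \<union> IB) R' D' f \<pi> \<and>
           equivalent_representations E scl UNIV \<Phi>
             fun_scale (finsupp_functions ((\<Union>u\<in>verts E. D u) \<union> IB)) \<pi>))"
proof -
  interpret adapted_lpa_module scl E \<Phi> VU VB R D IU IB m
    using V graph rep complements basis permutes kills
    unfolding adapted_lpa_module_def lpa_module_def lpa_module_axioms_def adapted_lpa_module_axioms_def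
    by (auto simp: countable_graph_def)
  show ?thesis
  proof (intro conjI impI)
    show "\<exists>R' D' f \<pi>.
        algebraic_branching_system E X R' D' f \<and>
        induced_representation E X R' D' f \<pi> \<and>
        equivalent_representations E scl W (\<lambda>a. restrict (\<Phi> a) W) fun_scale (finsupp_functions X) \<pi>"
      using branching_system[OF subset_refl] total_branching_representation by blast
  next
    assume "\<exists>VB'. is_direct_sum scl UNIV W VB' \<and>
               (\<forall>u\<in>verts E. \<forall>w\<in>VB'. \<Phi> (lpa_vertex E u) w = 0)"
    then show "\<exists>R' D' f \<pi>.
        algebraic_branching_system E (X \<union> IB) R' D' f \<and>
        induced_representation E (X \<union> IB) R' D' f \<pi> \<and>
        equivalent_representations E scl UNIV \<Phi> fun_scale (finsupp_functions (X \<union> IB)) \<pi>"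
      using branching_system[of "X \<union> IB"] full_branching_representation by blast
  qed
qed

end
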